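(* Fix $\sigma>0$ and let $\tilde g_\sigma$ be a probability density on $\mathbb{R}$ that is $\sigma$-subgaussian, bounded, and monotonically decreases as its argument goes away from zero in either direction. Set $\delta=\min\{1,\frac{1}{4\sigma^2}\}$. Then there is a constant $c_1>0$, depending only on $\sigma$ and $\tilde g_\sigma$, such that the following holds for every $d\ge1$. Let $\mathcal{G}_\sigma\in\mathcal{P}_1(\mathbb{R}^d)$ be the probability measure with density $g_\sigma(x)=\prod_{j=1}^d\tilde g_\sigma(x_j)$. Then $g_\sigma(t)\le c_1^d e^{\delta\|t\|^2}\varphi_\sigma(t)$ for all $t\in\mathbb{R}^d$, and for every $K>0$, every $K$-subgaussian $\mu\in\mathcal{P}_1(\mathbb{R}^d)$ and every $n\geq 1$, $$\mathbb{E}_{\mu^{\otimes n}}\,\mathsf{W}_1^{(\mathcal{G}_\sigma)}(\hat\mu_n,\mu)\le c_{\sigma,d,K}\,n^{-1/2},$$ where $$c_{\sigma,d,K}=c_1^d\,\sigma\sqrt{2d}\left(1+\frac{K}{\sigma}\right)^{\frac d2+1}e^{\frac{3d}{16}}=e^{O(d)}.$$ In particular (taking $\mathcal{G}_\sigma=\mathcal{N}_\sigma$), $\mathbb{E}_{\mu^{\otimes n}}\,\mathsf{W}_1^{(\sigma)}(\hat\mu_n,\mu)\in O(n^{-1/2})$ as $n\to\infty$.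
   Context: $\mathcal{P}_1(\mathbb{R}^d)$ is the set of Borel probability measures on $\mathbb{R}^d$ with finite first moment; $\|\cdot\|$ is the Euclidean norm. A probability measure $\mu\in\mathcal{P}_1(\mathbb{R}^d)$ is $K$-subgaussian, $K>0$, if for every $\alpha\in\mathbb{R}^d$, $X\sim\mu$ satisfies $\mathbb{E}_\mu[e^{\alpha^T(X-\mathbb{E}X)}]\le e^{\frac12K^2\|\alpha\|^2}$. A density is called $\sigma$-subgaussian if the probability measure it defines is. "Monotonically decreases away from zero in either direction" means $\tilde g_\sigma(s)\ge\tilde g_\sigma(t)$ whenever $0\le s\le t$ or $t\le s\le0$. $\mathcal{N}_\sigma=\mathcal{N}(0,\sigma^2\mathrm{I}_d)$ is the isotropic Gaussian measure on $\mathbb{R}^d$ and $\varphi_\sigma$ is its density. $\hat\mu_n=\frac1n\sum_{i=1}^n\delta_{X_i}$ is the empirical measure of $(X_1,\dots,X_n)\sim\mu^{\otimes n}$ (i.i.d. samples from $\mu$), $\delta_x$ being the Dirac measure at $x$. $\mathsf{W}_1(\alpha,\beta)=\inf_{\pi}\int\|x-y\|\,d\pi(x,y)$, the infimum over all couplings $\pi$ of $\alpha$ and $\beta$. With $\ast$ denoting convolution of measures, $\mathsf{W}_1^{(\mathcal{G}_\sigma)}(\mu,\nu)=\mathsf{W}_1(\mu\ast\mathcal{G}_\sigma,\nu\ast\mathcal{G}_\sigma)$ and $\mathsf{W}_1^{(\sigma)}=\mathsf{W}_1^{(\mathcal{N}_\sigma)}$. The notation $e^{O(d)}$ is for $\sigma,K$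 and $\tilde g_\sigma$ fixed; the implicit constant in $O(n^{-1/2})$ may depend on $\sigma,d,K$. *)

theory Defs
  imports "HOL-Probability.Probability" "HOL-Library.Landau_Symbols"
begin

text \<open>
  The dimension \<open>d\<close> is quantified inside the theorem (after a constant that must not depend
  on it), so it cannot be a type.  A vector of \<open>\<real>\<^sup>d\<close> is an extensional function on
  \<open>{..<d}\<close>; the Borel sets of \<open>\<real>\<^sup>d\<close> are the product sigma-algebra.
\<close>

definition borel_vec :: "nat \<Rightarrow> (nat \<Rightarrow> real) measure" where
  "borel_vec d = (\<Pi>\<^sub>M i\<in>{..<d}. borel)"

definition lborel_vec :: "nat \<Rightarrow> (nat \<Rightarrow> real) measure" where
  "lborel_vec d = (\<Pi>\<^sub>M i\<in>{..<d}. lborel)"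

definition vnorm :: "nat \<Rightarrow> (nat \<Rightarrow> real) \<Rightarrow> real" where
  "vnorm d x = L2_set x {..<d}"

definition P1 :: "nat \<Rightarrow> (nat \<Rightarrow> real) measure set" where
  "P1 d = {\<mu>. prob_space \<mu> \<and> sets \<mu> = sets (borel_vec d) \<and> integrable \<mu> (vnorm d)}"

text \<open>
  The exponential moments are extended nonnegative integrals, so that the
  inequalities include their finiteness.
\<close>

definition subgaussian :: "nat \<Rightarrow> real \<Rightarrow> (nat \<Rightarrow> real) measure \<Rightarrow> bool" where
  "subgaussian d K \<mu> \<longleftrightarrow> \<mu> \<in> P1 d \<and>
     (\<forall>\<alpha>. (\<integral>\<^sup>+x. ennreal (exp (\<Sum>i<d. \<alpha> i * (x i - (\<integral>y. y i \<partial>\<mu>)))) \<partial>\<mu>)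
            \<le> ennreal (exp (1/2 * K\<^sup>2 * (vnorm d \<alpha>)\<^sup>2)))"

definition prob_density :: "(real \<Rightarrow> real) \<Rightarrow> bool" where
  "prob_density g \<longleftrightarrow>
     g \<in> borel_measurable borel \<and> (\<forall>x. 0 \<le> g x) \<and> (\<integral>\<^sup>+x. ennreal (g x) \<partial>lborel) = 1"

definition subgaussian_density :: "real \<Rightarrow> (real \<Rightarrow> real) \<Rightarrow> bool" where
  "subgaussian_density \<sigma> g \<longleftrightarrow> prob_density g \<and>
     (let M = density lborel (\<lambda>x. ennreal (g x)) in
        integrable M (\<lambda>x. x) \<and>
        (\<forall>a. (\<integral>\<^sup>+x. ennreal (exp (a * (x - (\<integral>y. y \<partial>M)))) \<partial>M)
               \<le> ennreal (exp (1/2 * \<sigma>\<^sup>2 * a\<^sup>2))))"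

definition decreasing_from_zero :: "(real \<Rightarrow> real) \<Rightarrow> bool" where
  "decreasing_from_zero g \<longleftrightarrow>
     (\<forall>s t. (0 \<le> s \<and> s \<le> t) \<or> (t \<le> s \<and> s \<le> 0) \<longrightarrow> g s \<ge> g t)"

definition product_density :: "nat \<Rightarrow> (real \<Rightarrow> real) \<Rightarrow> (nat \<Rightarrow> real) \<Rightarrow> real" where
  "product_density d g x = (\<Prod>j<d. g (x j))"

definition product_law :: "nat \<Rightarrow> (real \<Rightarrow> real) \<Rightarrow> (nat \<Rightarrow> real) measure" where
  "product_law d g = density (lborel_vec d) (\<lambda>x. ennreal (product_density d g x))"

definition gaussian_density :: "nat \<Rightarrow> real \<Rightarrow> (nat \<Rightarrow> real) \<Rightarrow> real" where
  "gaussian_density d \<sigma> x =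
     exp (- (vnorm d x)\<^sup>2 / (2 * \<sigma>\<^sup>2)) / (2 * pi * \<sigma>\<^sup>2) powr (real d / 2)"

definition gaussian_law :: "nat \<Rightarrow> real \<Rightarrow> (nat \<Rightarrow> real) measure" where
  "gaussian_law d \<sigma> = density (lborel_vec d) (\<lambda>x. ennreal (gaussian_density d \<sigma> x))"

definition conv_vec ::
    "nat \<Rightarrow> (nat \<Rightarrow> real) measure \<Rightarrow> (nat \<Rightarrow> real) measure \<Rightarrow> (nat \<Rightarrow> real) measure" where
  "conv_vec d \<mu> \<nu> = distr (\<mu> \<Otimes>\<^sub>M \<nu>) (borel_vec d) (\<lambda>(x, y). \<lambda>i\<in>{..<d}. x i + y i)"

definition couplings ::
    "nat \<Rightarrow> (nat \<Rightarrow> real) measure \<Rightarrow> (nat \<Rightarrow> real) measure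
       \<Rightarrow> ((nat \<Rightarrow> real) \<times> (nat \<Rightarrow> real)) measure set" where
  "couplings d \<alpha> \<beta> =
     {p. prob_space p \<and> sets p = sets (borel_vec d \<Otimes>\<^sub>M borel_vec d) \<and>
         distr p (borel_vec d) fst = \<alpha> \<and> distr p (borel_vec d) snd = \<beta>}"

definition W1 :: "nat \<Rightarrow> (nat \<Rightarrow> real) measure \<Rightarrow> (nat \<Rightarrow> real) measure \<Rightarrow> ennreal" where
  "W1 d \<alpha> \<beta> =
     (INF p\<in>couplings d \<alpha> \<beta>. \<integral>\<^sup>+(x, y). ennreal (vnorm d (\<lambda>i. x i - y i)) \<partial>p)"

definition smooth_W1 ::
    "nat \<Rightarrow> (nat \<Rightarrow> real) measure \<Rightarrow> (nat \<Rightarrow> real) measure \<Rightarrow> (nat \<Rightarrow> real) measure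
       \<Rightarrow> ennreal" where
  "smooth_W1 d G \<mu> \<nu> = W1 d (conv_vec d \<mu> G) (conv_vec d \<nu> G)"

definition empirical :: "nat \<Rightarrow> nat \<Rightarrow> (nat \<Rightarrow> nat \<Rightarrow> real) \<Rightarrow> (nat \<Rightarrow> real) measure" where
  "empirical d n X = measure_of (space (borel_vec d)) (sets (borel_vec d))
     (\<lambda>A. (\<Sum>i<n. emeasure (return (borel_vec d) (X i)) A) / of_nat n)"

text \<open>The set function above is a measure, so \<^const>\<open>measure_of\<close> does not degenerate.\<close>

lemma sets_empirical [simp]: "sets (empirical d n X) = sets (borel_vec d)"
  by (simp add: empirical_def)

lemma emeasure_empirical:
  assumes "A \<in> sets (borel_vec d)"
  shows "emeasure (empirical d n X) A =
    (\<Sum>i<n. emeasure (return (borel_vec d) (X i)) A) / of_nat n"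
proof (rule emeasure_measure_of[OF empirical_def])
  show "sets (borel_vec d) \<subseteq> Pow (space (borel_vec d))"
    by (rule sets.space_closed)
  show "A \<in> sets (empirical d n X)"
    using assms by simp
  show "positive (sets (empirical d n X))
      (\<lambda>A. (\<Sum>i<n. emeasure (return (borel_vec d) (X i)) A) / of_nat n)"
    by (simp add: positive_def)
  show "countably_additive (sets (empirical d n X))
      (\<lambda>A. (\<Sum>i<n. emeasure (return (borel_vec d) (X i)) A) / of_nat n)"
  proof (rule countably_additiveI)
    fix F :: "nat \<Rightarrow> (nat \<Rightarrow> real) set"
    assume F: "range F \<subseteq> sets (empirical d n X)" "disjoint_family F"
    have "(\<Sum>k. (\<Sum>i<n. emeasure (return (borel_vec d) (X i)) (F k)) / of_nat n)
        = (\<Sum>i<n. \<Sum>k. emeasure (return (borel_vec d) (X i)) (F k)) / of_nat n"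
      by (simp add: divide_ennreal_def ennreal_suminf_multc suminf_sum)
    also have "\<dots> = (\<Sum>i<n. emeasure (return (borel_vec d) (X i)) (\<Union>k. F k)) / of_nat n"
      using F by (subst suminf_emeasure) auto
    finally show "(\<Sum>k. (\<Sum>i<n. emeasure (return (borel_vec d) (X i)) (F k)) / of_nat n)
        = (\<Sum>i<n. emeasure (return (borel_vec d) (X i)) (\<Union>k. F k)) / of_nat n" .
  qed
qed

text \<open>
  The expected smoothed distance between \<open>\<mu>\<close> and the empirical measure of \<open>n\<close> i.i.d. samples,
  as an extended nonnegative real: no integrability is presupposed.
\<close>

definition expected_smooth_W1 ::
    "nat \<Rightarrow> (nat \<Rightarrow> real) measure \<Rightarrow> (nat \<Rightarrow> real) measure \<Rightarrow> nat \<Rightarrow> ennreal" where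
  "expected_smooth_W1 d G \<mu> n =
     (\<integral>\<^sup>+X. smooth_W1 d G (empirical d n X) \<mu> \<partial>(\<Pi>\<^sub>M i\<in>{..<n}. \<mu>))"

definition rate_const :: "real \<Rightarrow> real \<Rightarrow> nat \<Rightarrow> real \<Rightarrow> real" where
  "rate_const c\<^sub>1 \<sigma> d K =
     c\<^sub>1 ^ d * \<sigma> * sqrt (2 * real d) * (1 + K / \<sigma>) powr (real d / 2 + 1)
       * exp (3 * real d / 16)"

end

theory Submission
  imports Defs
begin

text \<open>
  Convolution with a density smooths both measures, and the distance of the smoothed measures
  is bounded by a weighted total variation: leaving the common mass in place and coupling the
  rest independently (\<open>W1_density_le\<close>) gives \<open>\<integral> \<parallel>z - m\<parallel> \<bar>r\<^sub>n z - r z\<bar> dz\<close>, where \<open>m\<close> is the mean of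
  \<open>\<mu>\<close>, \<open>r z\<close> is the expectation of \<open>g (z - X)\<close> and \<open>r\<^sub>n z\<close> is the average of \<open>g (z - X\<^sub>i)\<close> over the samples.
  For each \<open>z\<close> this is an average of i.i.d. bounded variables, so that the expected square of
  \<open>r\<^sub>n z - r z\<close> is at most \<open>1 / n\<close> times the expectation of \<open>g (z - X)\<^sup>2\<close>
  (\<open>nn_integral_sq_empirical_deviation\<close>); the curse of dimensionality does not enter the rate.

  It remains to integrate over \<open>z\<close>.  Young's inequality with the weight \<open>exp (- a \<parallel>z - m\<parallel>\<^sup>2)\<close>
  (\<open>expected_smooth_W1_young\<close>) leaves the product of two quantities: the second moment of the
  weight, and the expectation of \<open>\<integral> g (z - X)\<^sup>2 exp (a \<parallel>z - m\<parallel>\<^sup>2) dz\<close>.  Both become Gaussian integrals that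
  factor over the coordinates.  The second one is finite because \<open>g\<^sup>2\<close> decays like
  \<open>exp (- \<parallel>t\<parallel>\<^sup>2 / (2 \<sigma>\<^sup>2))\<close> and because \<open>exp (2 a \<parallel>X - m\<parallel>\<^sup>2)\<close> is integrable for subgaussian \<open>X\<close> and small \<open>a\<close>
  (\<open>subgaussian_exp_sq\<close>).  Taking \<open>a\<close> of order \<open>(\<sigma> + K)\<^sup>-\<^sup>2\<close> produces the claimed power of \<open>1 + K / \<sigma>\<close>
  (\<open>expected_smooth_W1_le\<close>); the remaining constants are of the form \<open>C ^ d\<close> with \<open>C\<close> proportional to the
  constant of the envelope, and a multiple of that constant serves as \<open>c\<^sub>1\<close>.

  The noise enters through the one-dimensional envelope
  \<open>g t \<le> c exp (\<delta> t\<^sup>2) \<phi> t\<close>, where \<open>\<phi>\<close> is the centered normal density with variance \<open>\<sigma>\<^sup>2\<close>.  For a bounded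
  subgaussian density that decreases away from zero it follows from a Chernoff bound
  (\<open>subgaussian_density_envelope\<close>); for the Gaussian itself it is trivial.
\<close>

section \<open>Vectors and their norm\<close>

lemma sets_lborel_vec [simp, measurable_cong]: "sets (lborel_vec d) = sets (borel_vec d)"
  unfolding lborel_vec_def borel_vec_def by (rule sets_PiM_cong) simp_all

lemma space_borel_vec: "space (borel_vec d) = PiE {..<d} (\<lambda>_. UNIV)"
  by (simp add: borel_vec_def space_PiM)

lemma space_lborel_vec [simp]: "space (lborel_vec d) = space (borel_vec d)"
  by (rule sets_eq_imp_space_eq) simp

lemma sigma_finite_lborel_vec: "sigma_finite_measure (lborel_vec d)"
proof -
  interpret product_sigma_finite "\<lambda>_::nat. lborel :: real measure" by standard
  show ?thesis
    unfolding lborel_vec_def by (rule sigma_finite) simp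
qed

lemma measurable_borel_vec_component [measurable (raw)]:
  "i < d \<Longrightarrow> (\<lambda>x. x i) \<in> borel_measurable (borel_vec d)"
  unfolding borel_vec_def by (rule measurable_component_singleton) simp

lemma measurable_component_compose:
  assumes "f \<in> measurable M (borel_vec d)" "i < d"
  shows "(\<lambda>x. f x i) \<in> borel_measurable M"
  using measurable_compose[OF assms(1) measurable_borel_vec_component[OF assms(2)]] .

lemma measurable_borel_vecI:
  assumes "\<And>i. i < d \<Longrightarrow> (\<lambda>x. f x i) \<in> borel_measurable M"
  shows "(\<lambda>x. \<lambda>i\<in>{..<d}. f x i) \<in> measurable M (borel_vec d)"
  unfolding borel_vec_def by (rule measurable_restrict) (use assms in auto)

lemma measurable_prod_component:
  assumes "f \<in> measurable M (borel_vec d)" "\<And>i. i < d \<Longrightarrow> h i \<in> borel_measurable borel"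
  shows "(\<lambda>x. \<Prod>i<d. (h i (f x i) :: real)) \<in> borel_measurable M"
proof (rule borel_measurable_prod)
  fix i assume "i \<in> {..<d}"
  then show "(\<lambda>x. h i (f x i)) \<in> borel_measurable M"
    using measurable_compose[OF measurable_component_compose[OF assms(1), of i] assms(2)[of i]] by simp
qed

lemma vnorm_sq: "(vnorm d x)\<^sup>2 = (\<Sum>i<d. (x i)\<^sup>2)"
  by (simp add: vnorm_def L2_set_def sum_nonneg)

lemma vnorm_nonneg [simp]: "0 \<le> vnorm d x"
  by (simp add: vnorm_def)

lemma measurable_vnorm_diff:
  assumes "f \<in> measurable M (borel_vec d)" "g \<in> measurable M (borel_vec d)"
  shows "(\<lambda>x. vnorm d (\<lambda>i. f x i - g x i)) \<in> borel_measurable M"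
  unfolding vnorm_def L2_set_def
  using measurable_component_compose[OF assms(1)] measurable_component_compose[OF assms(2)]
  by (intro borel_measurable_sqrt borel_measurable_sum borel_measurable_power
      borel_measurable_diff measurable_compose[OF _ borel_measurable_sqrt]) auto

lemma measurable_vnorm_centered [measurable]:
  "(\<lambda>x. vnorm d (\<lambda>i. x i - m i)) \<in> borel_measurable (borel_vec d)"
  unfolding vnorm_def L2_set_def
  by (intro measurable_compose[OF _ borel_measurable_sqrt] borel_measurable_sum borel_measurable_power
      borel_measurable_diff) auto

lemma vnorm_triangle_via:
  "vnorm d (\<lambda>i. x i - y i) \<le> vnorm d (\<lambda>i. x i - m i) + vnorm d (\<lambda>i. y i - m i)"
proof -
  have "vnorm d (\<lambda>i. x i - y i) = L2_set (\<lambda>i. (x i - m i) + (m i - y i)) {..<d}"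
    by (simp add: vnorm_def)
  also have "\<dots> \<le> L2_set (\<lambda>i. x i - m i) {..<d} + L2_set (\<lambda>i. m i - y i) {..<d}"
    by (rule L2_set_triangle_ineq)
  also have "L2_set (\<lambda>i. m i - y i) {..<d} = L2_set (\<lambda>i. y i - m i) {..<d}"
    by (simp add: L2_set_def power2_commute)
  finally show ?thesis by (simp add: vnorm_def)
qed

section \<open>Lebesgue measure on \<open>\<real>\<^sup>d\<close> and convolution\<close>

lemma nn_integral_lborel_vec_prod:
  assumes "\<And>i. i < d \<Longrightarrow> f i \<in> borel_measurable borel" "\<And>i x. 0 \<le> f i x"
  shows "(\<integral>\<^sup>+x. ennreal (\<Prod>i<d. f i (x i)) \<partial>lborel_vec d)
    = (\<Prod>i<d. \<integral>\<^sup>+t. ennreal (f i t) \<partial>lborel)"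
proof -
  interpret product_sigma_finite "\<lambda>_::nat. lborel :: real measure" by standard
  have "(\<integral>\<^sup>+x. ennreal (\<Prod>i<d. f i (x i)) \<partial>lborel_vec d)
      = (\<integral>\<^sup>+x. (\<Prod>i<d. ennreal (f i (x i))) \<partial>lborel_vec d)"
    by (simp add: prod_ennreal assms(2))
  also have "\<dots> = (\<Prod>i<d. \<integral>\<^sup>+t. ennreal (f i t) \<partial>lborel)"
    unfolding lborel_vec_def
    by (rule product_nn_integral_prod) (use assms(1) in auto)
  finally show ?thesis .
qed

text \<open>
  A translate of a box is a box with translated sides, and boxes determine a product measure.
\<close>

lemma distr_lborel_vec_shift:
  "distr (lborel_vec d) (lborel_vec d) (\<lambda>y. \<lambda>i\<in>{..<d}. x i + y i) = lborel_vec d"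
proof -
  interpret product_sigma_finite "\<lambda>_::nat. lborel :: real measure" by standard
  let ?T = "\<lambda>y. \<lambda>i\<in>{..<d}. x i + y i"
  have T [measurable]: "?T \<in> measurable (lborel_vec d) (lborel_vec d)"
    using measurable_borel_vecI[of d "\<lambda>y i. x i + y i" "borel_vec d"]
    by (simp cong: measurable_cong_sets)
  show ?thesis
    unfolding lborel_vec_def
  proof (rule PiM_eqI)
    fix A :: "nat \<Rightarrow> real set" assume "\<And>i. i \<in> {..<d} \<Longrightarrow> A i \<in> sets lborel"
    then have A [measurable]: "\<And>i. i < d \<Longrightarrow> A i \<in> sets borel" by auto
    have box: "Pi\<^sub>E {..<d} A \<in> sets (lborel_vec d)"
      unfolding lborel_vec_def by (rule sets_PiM_I_finite) (use A in auto)
    have pre: "(+) c -` S \<in> sets borel" if "S \<in> sets borel" for c :: real and S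
      using measurable_sets[of "(+) c" borel borel S] that by auto
    have "emeasure (distr (lborel_vec d) (lborel_vec d) ?T) (Pi\<^sub>E {..<d} A)
        = emeasure (lborel_vec d) (?T -` Pi\<^sub>E {..<d} A \<inter> space (lborel_vec d))"
      by (rule emeasure_distr[OF T box])
    also have "?T -` Pi\<^sub>E {..<d} A \<inter> space (lborel_vec d) = Pi\<^sub>E {..<d} (\<lambda>i. (+) (x i) -` A i)"
      by (auto simp: space_borel_vec PiE_iff extensional_def)
    also have "emeasure (lborel_vec d) \<dots> = (\<Prod>i<d. emeasure lborel ((+) (x i) -` A i))"
      unfolding lborel_vec_def by (rule emeasure_PiM) (use A pre in auto)
    also have "\<dots> = (\<Prod>i<d. emeasure lborel (A i))"
    proof (rule prod.cong[OF refl])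
      fix i assume "i \<in> {..<d}"
      then have "emeasure (distr lborel borel ((+) (x i))) (A i) = emeasure lborel ((+) (x i) -` A i)"
        using A by (subst emeasure_distr) auto
      then show "emeasure lborel ((+) (x i) -` A i) = emeasure lborel (A i)"
        by (simp add: lborel_distr_plus)
    qed
    finally show "emeasure (distr (Pi\<^sub>M {..<d} (\<lambda>_. lborel)) (Pi\<^sub>M {..<d} (\<lambda>_. lborel)) ?T) (Pi\<^sub>E {..<d} A)
        = (\<Prod>i<d. emeasure lborel (A i))"
      unfolding lborel_vec_def .
  qed simp_all
qed

lemma nn_integral_lborel_vec_shift:
  assumes f [measurable]: "f \<in> borel_measurable (borel_vec d)"
  shows "(\<integral>\<^sup>+y. f (\<lambda>i\<in>{..<d}. x i + y i) \<partial>lborel_vec d) = (\<integral>\<^sup>+z. f z \<partial>lborel_vec d)"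
proof -
  have T: "(\<lambda>y. \<lambda>i\<in>{..<d}. x i + y i) \<in> measurable (lborel_vec d) (lborel_vec d)"
    using measurable_borel_vecI[of d "\<lambda>y i. x i + y i" "borel_vec d"]
    by (simp cong: measurable_cong_sets)
  have f': "f \<in> borel_measurable (lborel_vec d)"
    using f by (simp cong: measurable_cong_sets)
  have "(\<integral>\<^sup>+z. f z \<partial>lborel_vec d)
      = (\<integral>\<^sup>+z. f z \<partial>distr (lborel_vec d) (lborel_vec d) (\<lambda>y. \<lambda>i\<in>{..<d}. x i + y i))"
    by (simp add: distr_lborel_vec_shift)
  also have "\<dots> = (\<integral>\<^sup>+y. f (\<lambda>i\<in>{..<d}. x i + y i) \<partial>lborel_vec d)"
    using T f' by (intro nn_integral_distr) simp_all
  finally show ?thesis ..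
qed

lemma measurable_vec_diff_sum:
  assumes "sets M = sets (borel_vec d)" "sets M' = sets (borel_vec d)"
  shows "(\<lambda>(x, y). \<lambda>i\<in>{..<d}. y i - x i) \<in> measurable (M \<Otimes>\<^sub>M M') (borel_vec d)"
    and "(\<lambda>(x, y). \<lambda>i\<in>{..<d}. x i + y i) \<in> measurable (M \<Otimes>\<^sub>M M') (borel_vec d)"
proof -
  have f: "fst \<in> measurable (M \<Otimes>\<^sub>M M') (borel_vec d)" and s: "snd \<in> measurable (M \<Otimes>\<^sub>M M') (borel_vec d)"
    using measurable_fst[of M M'] measurable_snd[of M M'] assms by (simp_all cong: measurable_cong_sets)
  note [measurable] = measurable_component_compose[OF f] measurable_component_compose[OF s]
  show "(\<lambda>(x, y). \<lambda>i\<in>{..<d}. y i - x i) \<in> measurable (M \<Otimes>\<^sub>M M') (borel_vec d)"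
    unfolding split_beta' by (rule measurable_borel_vecI) measurable
  show "(\<lambda>(x, y). \<lambda>i\<in>{..<d}. x i + y i) \<in> measurable (M \<Otimes>\<^sub>M M') (borel_vec d)"
    unfolding split_beta' by (rule measurable_borel_vecI) measurable
qed

text \<open>
  After integrating out \<open>x\<close>, the substitution \<open>z = x + y\<close> and Tonelli's theorem exhibit the
  Lebesgue density of the law of a sum.  The restriction to \<open>{..<d}\<close> returns
  \<open>z - x\<close> to the extensional functions, outside of which \<open>G\<close> is unconstrained.
\<close>

lemma conv_vec_density:
  assumes "prob_space \<mu>" and sets_\<mu> [measurable_cong]: "sets \<mu> = sets (borel_vec d)"
    and G [measurable]: "G \<in> borel_measurable (borel_vec d)"
    and "prob_space (density (lborel_vec d) G)"
  shows "conv_vec d \<mu> (density (lborel_vec d) G)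
    = density (lborel_vec d) (\<lambda>z. \<integral>\<^sup>+x. G (\<lambda>i\<in>{..<d}. z i - x i) \<partial>\<mu>)"
proof -
  interpret \<mu>: prob_space \<mu> by fact
  interpret G: prob_space "density (lborel_vec d) G" by fact
  interpret N: sigma_finite_measure "lborel_vec d" by (rule sigma_finite_lborel_vec)
  interpret \<mu>N: pair_sigma_finite \<mu> "lborel_vec d" ..
  note vec [measurable] = measurable_vec_diff_sum[OF sets_\<mu> sets_lborel_vec]
    measurable_vec_diff_sum[OF sets_\<mu> refl]
  have Gm [measurable]: "(\<lambda>p. G (\<lambda>i\<in>{..<d}. snd p i - fst p i)) \<in> borel_measurable (\<mu> \<Otimes>\<^sub>M lborel_vec d)"
    using measurable_compose[OF vec(1) G] by (simp add: split_beta')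
  have Gm' [measurable]: "(\<lambda>z. \<integral>\<^sup>+x. G (\<lambda>i\<in>{..<d}. z i - x i) \<partial>\<mu>) \<in> borel_measurable (lborel_vec d)"
    by (rule \<mu>.borel_measurable_nn_integral) (use measurable_pair_swap[OF Gm] in \<open>simp add: split_beta'\<close>)
  show ?thesis
  proof (rule measure_eqI)
    fix A assume "A \<in> sets (conv_vec d \<mu> (density (lborel_vec d) G))"
    then have A [measurable]: "A \<in> sets (borel_vec d)"
      by (simp add: conv_vec_def)
    have Gx: "G (\<lambda>i\<in>{..<d}. (\<lambda>i\<in>{..<d}. x i + y i) i - x i) = G y" if "y \<in> space (lborel_vec d)" for x y
    proof -
      have "(\<lambda>i\<in>{..<d}. (\<lambda>i\<in>{..<d}. x i + y i) i - x i) = y"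
        using that by (auto simp: space_borel_vec PiE_iff extensional_def fun_eq_iff)
      then show ?thesis by simp
    qed
    have add: "(\<lambda>(x, y). \<lambda>i\<in>{..<d}. x i + y i) \<in> measurable (\<mu> \<Otimes>\<^sub>M density (lborel_vec d) G) (borel_vec d)"
      by (rule measurable_vec_diff_sum) (simp_all add: sets_\<mu>)
    have "emeasure (conv_vec d \<mu> (density (lborel_vec d) G)) A
        = (\<integral>\<^sup>+z. indicator A z \<partial>conv_vec d \<mu> (density (lborel_vec d) G))"
      by (simp add: conv_vec_def)
    also have "\<dots> = (\<integral>\<^sup>+p. indicator A (case p of (x, y) \<Rightarrow> \<lambda>i\<in>{..<d}. x i + y i) \<partial>(\<mu> \<Otimes>\<^sub>M density (lborel_vec d) G))"
      unfolding conv_vec_def by (rule nn_integral_distr[OF add]) measurable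
    also have "\<dots> = (\<integral>\<^sup>+x. \<integral>\<^sup>+y. indicator A (\<lambda>i\<in>{..<d}. x i + y i) \<partial>density (lborel_vec d) G \<partial>\<mu>)"
      using measurable_compose[OF add borel_measurable_indicator[OF A]]
      by (subst G.nn_integral_fst[symmetric]) simp_all
    also have "\<dots> = (\<integral>\<^sup>+x. \<integral>\<^sup>+z. G (\<lambda>i\<in>{..<d}. z i - x i) * indicator A z \<partial>lborel_vec d \<partial>\<mu>)"
    proof (rule nn_integral_cong)
      fix x assume x: "x \<in> space \<mu>"
      have [measurable]: "(\<lambda>y. \<lambda>i\<in>{..<d}. x i + y i) \<in> measurable (borel_vec d) (borel_vec d)"
          "(\<lambda>y. \<lambda>i\<in>{..<d}. y i - x i) \<in> measurable (borel_vec d) (borel_vec d)"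
        by (rule measurable_borel_vecI; measurable)+
      have "(\<integral>\<^sup>+y. indicator A (\<lambda>i\<in>{..<d}. x i + y i) \<partial>density (lborel_vec d) G)
          = (\<integral>\<^sup>+y. G y * indicator A (\<lambda>i\<in>{..<d}. x i + y i) \<partial>lborel_vec d)"
        by (subst nn_integral_density) auto
      also have "\<dots> = (\<integral>\<^sup>+y. (\<lambda>z. G (\<lambda>i\<in>{..<d}. z i - x i) * indicator A z) (\<lambda>i\<in>{..<d}. x i + y i) \<partial>lborel_vec d)"
        using Gx by (intro nn_integral_cong) auto
      also have "\<dots> = (\<integral>\<^sup>+z. G (\<lambda>i\<in>{..<d}. z i - x i) * indicator A z \<partial>lborel_vec d)"
        by (rule nn_integral_lborel_vec_shift) measurable
      finally show "(\<integral>\<^sup>+y. indicator A (\<lambda>i\<in>{..<d}. x i + y i) \<partial>density (lborel_vec d) G)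
          = (\<integral>\<^sup>+z. G (\<lambda>i\<in>{..<d}. z i - x i) * indicator A z \<partial>lborel_vec d)" .
    qed
    also have "\<dots> = (\<integral>\<^sup>+z. \<integral>\<^sup>+x. G (\<lambda>i\<in>{..<d}. z i - x i) * indicator A z \<partial>\<mu> \<partial>lborel_vec d)"
    proof (rule \<mu>N.Fubini'[symmetric])
      show "(\<lambda>(x, z). G (\<lambda>i\<in>{..<d}. z i - x i) * indicator A z) \<in> borel_measurable (\<mu> \<Otimes>\<^sub>M lborel_vec d)"
        using Gm unfolding split_beta' by measurable
    qed
    also have "\<dots> = (\<integral>\<^sup>+z. (\<integral>\<^sup>+x. G (\<lambda>i\<in>{..<d}. z i - x i) \<partial>\<mu>) * indicator A z \<partial>lborel_vec d)"
    proof (rule nn_integral_cong)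
      fix z assume "z \<in> space (lborel_vec d)"
      have "(\<lambda>x. \<lambda>i\<in>{..<d}. z i - x i) \<in> measurable \<mu> (borel_vec d)"
        unfolding measurable_cong_sets[OF sets_\<mu> refl] by (rule measurable_borel_vecI) measurable
      from measurable_compose[OF this G]
      show "(\<integral>\<^sup>+x. G (\<lambda>i\<in>{..<d}. z i - x i) * indicator A z \<partial>\<mu>)
          = (\<integral>\<^sup>+x. G (\<lambda>i\<in>{..<d}. z i - x i) \<partial>\<mu>) * indicator A z"
        by (rule nn_integral_multc)
    qed
    also have "\<dots> = emeasure (density (lborel_vec d) (\<lambda>z. \<integral>\<^sup>+x. G (\<lambda>i\<in>{..<d}. z i - x i) \<partial>\<mu>)) A"
      by (rule emeasure_density[symmetric]) (use Gm' in simp_all)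
    finally show "emeasure (conv_vec d \<mu> (density (lborel_vec d) G)) A
        = emeasure (density (lborel_vec d) (\<lambda>z. \<integral>\<^sup>+x. G (\<lambda>i\<in>{..<d}. z i - x i) \<partial>\<mu>)) A" .
  qed (simp add: conv_vec_def)
qed

section \<open>Optimal transport is bounded by a weighted total variation\<close>

text \<open>
  The excess mass \<open>T\<close> in the coupling below can be zero; then \<open>c * T / T = 0\<close>, which is still
  correct for every \<open>c \<le> T\<close>.
\<close>

lemma ennreal_mult_divide_self_le:
  fixes c T :: ennreal
  assumes "T \<noteq> \<top>"
  shows "c * T / T \<le> c"
proof (cases "T = 0")
  case False
  then show ?thesis
    using assms by (simp add: ennreal_times_divide[symmetric] ennreal_divide_self top.not_eq_extremum)
qed simp

lemma ennreal_mult_divide_self_eq: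
  fixes c T :: ennreal
  assumes "T \<noteq> \<top>" "c \<le> T"
  shows "c * T / T = c"
proof (cases "T = 0")
  case False
  then show ?thesis
    using assms by (simp add: ennreal_times_divide[symmetric] ennreal_divide_self top.not_eq_extremum)
qed (use assms in simp)

text \<open>
  The two measures share the mass \<open>w = min p q\<close>, which a coupling may leave where it is, on
  the diagonal.  The excess masses \<open>u = p - w\<close> and \<open>v = q - w\<close> have the same total \<open>T\<close> and
  are coupled independently, with density \<open>u x * v y / T\<close>.  Moving mass from \<open>x\<close> to \<open>y\<close>
  costs at most the sum of the distances of both points to \<open>m\<close>, and \<open>u + v = \<bar>p - q\<bar>\<close>.
\<close>

lemma W1_density_le:
  fixes p q :: "(nat \<Rightarrow> real) \<Rightarrow> real"
  assumes p [measurable]: "p \<in> borel_measurable (borel_vec d)"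
    and q [measurable]: "q \<in> borel_measurable (borel_vec d)"
    and p0: "\<And>z. 0 \<le> p z" and q0: "\<And>z. 0 \<le> q z"
    and p1: "(\<integral>\<^sup>+z. ennreal (p z) \<partial>lborel_vec d) = 1"
    and q1: "(\<integral>\<^sup>+z. ennreal (q z) \<partial>lborel_vec d) = 1"
  shows "W1 d (density (lborel_vec d) p) (density (lborel_vec d) q)
    \<le> (\<integral>\<^sup>+z. ennreal (vnorm d (\<lambda>i. z i - m i) * \<bar>p z - q z\<bar>) \<partial>lborel_vec d)"
proof -
  let ?N = "lborel_vec d" and ?B = "borel_vec d"
  interpret N: sigma_finite_measure ?N by (rule sigma_finite_lborel_vec)
  interpret C: sigma_finite_measure "count_space (UNIV :: bool set)"
    by (rule sigma_finite_measure_count_space_finite) simp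
  interpret NC: pair_sigma_finite ?N "count_space (UNIV :: bool set)" ..
  define w u v where "w = (\<lambda>z. min (p z) (q z))" and "u = (\<lambda>z. p z - w z)" and "v = (\<lambda>z. q z - w z)"
  have [measurable]: "w \<in> borel_measurable ?B" "u \<in> borel_measurable ?B" "v \<in> borel_measurable ?B"
    unfolding w_def u_def v_def by measurable
  have nonneg: "0 \<le> w z" "0 \<le> u z" "0 \<le> v z" for z
    using p0[of z] q0[of z] by (auto simp: w_def u_def v_def)
  have split: "ennreal (w z) + ennreal (u z) = ennreal (p z)" "ennreal (w z) + ennreal (v z) = ennreal (q z)" for z
    using nonneg[of z] by (simp_all flip: ennreal_plus) (simp_all add: u_def v_def)
  define T where "T = (\<integral>\<^sup>+z. ennreal (u z) \<partial>?N)"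
  have wT: "(\<integral>\<^sup>+z. ennreal (w z) \<partial>?N) + T = 1"
    unfolding T_def p1[symmetric] by (subst nn_integral_add[symmetric]) (simp_all add: split)
  have "(\<integral>\<^sup>+z. ennreal (w z) \<partial>?N) + (\<integral>\<^sup>+z. ennreal (v z) \<partial>?N) = 1"
    unfolding q1[symmetric] by (subst nn_integral_add[symmetric]) (simp_all add: split)
  then have eq: "(\<integral>\<^sup>+z. ennreal (w z) \<partial>?N) + (\<integral>\<^sup>+z. ennreal (v z) \<partial>?N) = (\<integral>\<^sup>+z. ennreal (w z) \<partial>?N) + T"
    by (simp only: wT)
  have w_fin: "(\<integral>\<^sup>+z. ennreal (w z) \<partial>?N) \<noteq> \<top>" and T_fin: "T \<noteq> \<top>"
    using wT by auto
  from eq w_fin have vT: "(\<integral>\<^sup>+z. ennreal (v z) \<partial>?N) = T"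
    by (simp only: ennreal_add_left_cancel) simp
  \<comment> \<open>The coupling is the image of a measure on \<open>\<real>\<^sup>d \<times> \<real>\<^sup>d \<times> bool\<close>, where the flag says
    whether the mass stays.  On the diagonal part the idle second coordinate follows
    the probability density \<open>q\<close>, so that it integrates to one.\<close>
  let ?R = "?N \<Otimes>\<^sub>M (?N \<Otimes>\<^sub>M count_space (UNIV :: bool set))"
  define h where "h = (\<lambda>(x, y, b). if b then ennreal (w x) * ennreal (q y)
    else ennreal (u x) * ennreal (v y) / T)"
  define \<phi> :: "_ \<times> _ \<times> bool \<Rightarrow> (nat \<Rightarrow> real) \<times> (nat \<Rightarrow> real)"
    where "\<phi> = (\<lambda>(x, y, b). (x, if b then x else y))"
  have h [measurable]: "h \<in> borel_measurable ?R"
    unfolding h_def by measurable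
  have \<phi> [measurable]: "\<phi> \<in> measurable ?R (?B \<Otimes>\<^sub>M ?B)"
    unfolding \<phi>_def by measurable
  define \<pi> where "\<pi> = distr (density ?R h) (?B \<Otimes>\<^sub>M ?B) \<phi>"
  \<comment> \<open>The total mass, the marginals and the cost of the coupling are instances of this formula.\<close>
  have int_\<pi>: "(\<integral>\<^sup>+z. F z \<partial>\<pi>) = (\<integral>\<^sup>+x. ennreal (w x) * F (x, x) \<partial>?N)
      + (\<integral>\<^sup>+x. \<integral>\<^sup>+y. ennreal (u x) * ennreal (v y) * F (x, y) \<partial>?N \<partial>?N) / T"
    if F [measurable]: "F \<in> borel_measurable (?B \<Otimes>\<^sub>M ?B)" for F
  proof -
    have "(\<integral>\<^sup>+z. F z \<partial>\<pi>) = (\<integral>\<^sup>+r. h r * F (\<phi> r) \<partial>?R)"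
      unfolding \<pi>_def by (subst nn_integral_distr) (simp_all add: nn_integral_density)
    also have "\<dots> = (\<integral>\<^sup>+x. \<integral>\<^sup>+r. h (x, r) * F (\<phi> (x, r)) \<partial>(?N \<Otimes>\<^sub>M count_space UNIV) \<partial>?N)"
      by (rule NC.P.nn_integral_fst[symmetric]) measurable
    also have "\<dots> = (\<integral>\<^sup>+x. \<integral>\<^sup>+y. ennreal (w x) * F (x, x) * ennreal (q y)
        + ennreal (u x) * ennreal (v y) * F (x, y) / T \<partial>?N \<partial>?N)"
    proof (rule nn_integral_cong)
      fix x assume x: "x \<in> space ?N"
      have "(\<integral>\<^sup>+r. h (x, r) * F (\<phi> (x, r)) \<partial>(?N \<Otimes>\<^sub>M count_space UNIV))
          = (\<integral>\<^sup>+y. \<integral>\<^sup>+b. h (x, y, b) * F (\<phi> (x, y, b)) \<partial>count_space UNIV \<partial>?N)"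
        using x by (intro C.nn_integral_fst[symmetric]) measurable
      also have "\<dots> = (\<integral>\<^sup>+y. ennreal (w x) * F (x, x) * ennreal (q y)
          + ennreal (u x) * ennreal (v y) * F (x, y) / T \<partial>?N)"
        by (intro nn_integral_cong)
          (simp add: nn_integral_count_space_finite UNIV_bool h_def \<phi>_def divide_ennreal_def ac_simps)
      finally show "(\<integral>\<^sup>+r. h (x, r) * F (\<phi> (x, r)) \<partial>(?N \<Otimes>\<^sub>M count_space UNIV)) = \<dots>" .
    qed
    also have "\<dots> = (\<integral>\<^sup>+x. ennreal (w x) * F (x, x)
        + (\<integral>\<^sup>+y. ennreal (u x) * ennreal (v y) * F (x, y) \<partial>?N) / T \<partial>?N)"
    proof (rule nn_integral_cong)
      fix x assume x: "x \<in> space ?N"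
      then have [measurable]: "(\<lambda>y. F (x, y)) \<in> borel_measurable ?N"
        using measurable_compose[OF measurable_Pair1'[of x ?B ?B] F] by (simp cong: measurable_cong_sets)
      show "(\<integral>\<^sup>+y. ennreal (w x) * F (x, x) * ennreal (q y)
          + ennreal (u x) * ennreal (v y) * F (x, y) / T \<partial>?N)
        = ennreal (w x) * F (x, x)
        + (\<integral>\<^sup>+y. ennreal (u x) * ennreal (v y) * F (x, y) \<partial>?N) / T"
        by (simp add: nn_integral_add nn_integral_cmult nn_integral_divide q1)
    qed
    also have "\<dots> = (\<integral>\<^sup>+x. ennreal (w x) * F (x, x) \<partial>?N)
      + (\<integral>\<^sup>+x. \<integral>\<^sup>+y. ennreal (u x) * ennreal (v y) * F (x, y) \<partial>?N \<partial>?N) / T"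
      by (simp add: nn_integral_add nn_integral_divide)
    finally show ?thesis .
  qed
  have sets_\<pi>: "sets \<pi> = sets (?B \<Otimes>\<^sub>M ?B)"
    by (simp add: \<pi>_def)
  have le_T: "(\<integral>\<^sup>+x. ennreal (u x) * indicator A x \<partial>?N) \<le> T"
      "(\<integral>\<^sup>+x. ennreal (v x) * indicator A x \<partial>?N) \<le> T" for A
  proof -
    have le: "(\<integral>\<^sup>+x. ennreal (f x) * indicator A x \<partial>?N) \<le> (\<integral>\<^sup>+x. ennreal (f x) \<partial>?N)" for f
      by (intro nn_integral_mono) (simp add: indicator_def)
    show "(\<integral>\<^sup>+x. ennreal (u x) * indicator A x \<partial>?N) \<le> T"
        "(\<integral>\<^sup>+x. ennreal (v x) * indicator A x \<partial>?N) \<le> T"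
      using le[of u] le[of v] by (simp_all add: vT T_def[symmetric])
  qed
  have split_ind: "ennreal (w z) * indicator A z + ennreal (u z) * indicator A z = ennreal (p z) * indicator A z"
      "ennreal (w z) * indicator A z + ennreal (v z) * indicator A z = ennreal (q z) * indicator A z" for z A
    by (simp_all add: split[symmetric] distrib_right)
  have fst_\<pi>: "distr \<pi> ?B fst = density ?N p"
  proof (rule measure_eqI)
    fix A assume "A \<in> sets (distr \<pi> ?B fst)"
    then have A [measurable]: "A \<in> sets ?B" by simp
    have "emeasure (distr \<pi> ?B fst) A = (\<integral>\<^sup>+z. indicator A z \<partial>distr \<pi> ?B fst)"
      by simp
    also have "\<dots> = (\<integral>\<^sup>+z. indicator A (fst z) \<partial>\<pi>)"
      by (rule nn_integral_distr) (simp_all add: sets_\<pi> cong: measurable_cong_sets)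
    also have "\<dots> = (\<integral>\<^sup>+x. ennreal (w x) * indicator A x \<partial>?N)
      + (\<integral>\<^sup>+x. \<integral>\<^sup>+y. ennreal (u x) * ennreal (v y) * indicator A x \<partial>?N \<partial>?N) / T"
      by (subst int_\<pi>) simp_all
    also have "(\<integral>\<^sup>+x. \<integral>\<^sup>+y. ennreal (u x) * ennreal (v y) * indicator A x \<partial>?N \<partial>?N)
        = (\<integral>\<^sup>+x. ennreal (u x) * indicator A x * T \<partial>?N)"
      by (intro nn_integral_cong)
         (simp add: nn_integral_multc nn_integral_cmult vT ac_simps)
    also have "\<dots> = (\<integral>\<^sup>+x. ennreal (u x) * indicator A x \<partial>?N) * T"
      by (simp add: nn_integral_multc)
    also have "\<dots> / T = (\<integral>\<^sup>+x. ennreal (u x) * indicator A x \<partial>?N)"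
      by (rule ennreal_mult_divide_self_eq[OF T_fin le_T(1)])
    also have "(\<integral>\<^sup>+x. ennreal (w x) * indicator A x \<partial>?N) + \<dots> = (\<integral>\<^sup>+x. ennreal (p x) * indicator A x \<partial>?N)"
      by (simp add: nn_integral_add[symmetric] split_ind)
    also have "\<dots> = emeasure (density ?N p) A"
      by (simp add: emeasure_density)
    finally show "emeasure (distr \<pi> ?B fst) A = emeasure (density ?N p) A" .
  qed simp
  have snd_\<pi>: "distr \<pi> ?B snd = density ?N q"
  proof (rule measure_eqI)
    fix A assume "A \<in> sets (distr \<pi> ?B snd)"
    then have A [measurable]: "A \<in> sets ?B" by simp
    have "emeasure (distr \<pi> ?B snd) A = (\<integral>\<^sup>+z. indicator A z \<partial>distr \<pi> ?B snd)"
      by simp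
    also have "\<dots> = (\<integral>\<^sup>+z. indicator A (snd z) \<partial>\<pi>)"
      by (rule nn_integral_distr) (simp_all add: sets_\<pi> cong: measurable_cong_sets)
    also have "\<dots> = (\<integral>\<^sup>+x. ennreal (w x) * indicator A x \<partial>?N)
      + (\<integral>\<^sup>+x. \<integral>\<^sup>+y. ennreal (u x) * ennreal (v y) * indicator A y \<partial>?N \<partial>?N) / T"
      by (subst int_\<pi>) simp_all
    also have "(\<integral>\<^sup>+x. \<integral>\<^sup>+y. ennreal (u x) * ennreal (v y) * indicator A y \<partial>?N \<partial>?N)
        = (\<integral>\<^sup>+x. ennreal (u x) * (\<integral>\<^sup>+y. ennreal (v y) * indicator A y \<partial>?N) \<partial>?N)"
      by (intro nn_integral_cong) (simp add: nn_integral_cmult[symmetric] mult.assoc)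
    also have "\<dots> = (\<integral>\<^sup>+y. ennreal (v y) * indicator A y \<partial>?N) * T"
      by (simp add: nn_integral_multc T_def mult.commute)
    also have "\<dots> / T = (\<integral>\<^sup>+x. ennreal (v x) * indicator A x \<partial>?N)"
      by (rule ennreal_mult_divide_self_eq[OF T_fin le_T(2)])
    also have "(\<integral>\<^sup>+x. ennreal (w x) * indicator A x \<partial>?N) + \<dots> = (\<integral>\<^sup>+x. ennreal (q x) * indicator A x \<partial>?N)"
      by (simp add: nn_integral_add[symmetric] split_ind)
    also have "\<dots> = emeasure (density ?N q) A"
      by (simp add: emeasure_density)
    finally show "emeasure (distr \<pi> ?B snd) A = emeasure (density ?N q) A" .
  qed simp
  have "prob_space \<pi>"
  proof (rule prob_spaceI)
    have "emeasure \<pi> (space \<pi>) = (\<integral>\<^sup>+z. 1 \<partial>\<pi>)" by simp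
    also have "\<dots> = (\<integral>\<^sup>+x. ennreal (w x) \<partial>?N) + T * T / T"
      by (subst int_\<pi>) (simp_all add: nn_integral_cmult nn_integral_multc vT T_def[symmetric])
    also have "\<dots> = 1"
      using ennreal_mult_divide_self_eq[OF T_fin order_refl] wT by simp
    finally show "emeasure \<pi> (space \<pi>) = 1" .
  qed
  then have "\<pi> \<in> couplings d (density ?N p) (density ?N q)"
    using sets_\<pi> fst_\<pi> snd_\<pi> by (simp add: couplings_def)
  then have "W1 d (density ?N p) (density ?N q)
      \<le> (\<integral>\<^sup>+(x, y). ennreal (vnorm d (\<lambda>i. x i - y i)) \<partial>\<pi>)"
    unfolding W1_def by (rule INF_lower)
  also have "\<dots> = (\<integral>\<^sup>+x. \<integral>\<^sup>+y. ennreal (u x) * ennreal (v y) * ennreal (vnorm d (\<lambda>i. x i - y i)) \<partial>?N \<partial>?N) / T"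
    using measurable_vnorm_diff[OF measurable_fst measurable_snd, of d]
    by (subst int_\<pi>) (simp_all add: split_beta' vnorm_def L2_set_def)
  also have "\<dots> \<le> (\<integral>\<^sup>+x. \<integral>\<^sup>+y. ennreal (u x * vnorm d (\<lambda>i. x i - m i)) * ennreal (v y)
      + ennreal (u x) * ennreal (v y * vnorm d (\<lambda>i. y i - m i)) \<partial>?N \<partial>?N) / T"
  proof (intro divide_right_mono_ennreal nn_integral_mono)
    fix x y
    have "u x * v y * vnorm d (\<lambda>i. x i - y i)
        \<le> u x * v y * (vnorm d (\<lambda>i. x i - m i) + vnorm d (\<lambda>i. y i - m i))"
      using nonneg by (intro mult_left_mono vnorm_triangle_via) auto
    then show "ennreal (u x) * ennreal (v y) * ennreal (vnorm d (\<lambda>i. x i - y i))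
        \<le> ennreal (u x * vnorm d (\<lambda>i. x i - m i)) * ennreal (v y)
      + ennreal (u x) * ennreal (v y * vnorm d (\<lambda>i. y i - m i))"
      using nonneg by (simp flip: ennreal_mult ennreal_plus) (simp add: algebra_simps)
  qed
  also have "\<dots> = ((\<integral>\<^sup>+x. ennreal (u x * vnorm d (\<lambda>i. x i - m i)) \<partial>?N)
      + (\<integral>\<^sup>+y. ennreal (v y * vnorm d (\<lambda>i. y i - m i)) \<partial>?N)) * T / T"
    by (simp add: nn_integral_add nn_integral_cmult nn_integral_multc vT T_def[symmetric] distrib_left distrib_right mult.commute)
  also have "\<dots> \<le> (\<integral>\<^sup>+x. ennreal (u x * vnorm d (\<lambda>i. x i - m i)) \<partial>?N)
      + (\<integral>\<^sup>+y. ennreal (v y * vnorm d (\<lambda>i. y i - m i)) \<partial>?N)"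
    by (rule ennreal_mult_divide_self_le[OF T_fin])
  also have "\<dots> = (\<integral>\<^sup>+x. ennreal (u x * vnorm d (\<lambda>i. x i - m i)) + ennreal (v x * vnorm d (\<lambda>i. x i - m i)) \<partial>?N)"
    by (rule nn_integral_add[symmetric]) measurable
  also have "\<dots> = (\<integral>\<^sup>+z. ennreal (vnorm d (\<lambda>i. z i - m i) * \<bar>p z - q z\<bar>) \<partial>?N)"
    using nonneg
    by (intro nn_integral_cong, simp flip: ennreal_plus)
       (auto simp: u_def v_def w_def min_def algebra_simps intro!: arg_cong[where f=ennreal])
  finally show ?thesis .
qed

section \<open>Mean squared error of an empirical average\<close>

text \<open>
  Centered summands at different indices are orthogonal, so that the second moment of the sum
  is the sum of \<open>n\<close> variances.
\<close>

lemma (in prob_space) nn_integral_sq_empirical_deviation: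
  fixes h :: "'a \<Rightarrow> real"
  assumes h [measurable]: "h \<in> borel_measurable M" and bound: "\<And>x. x \<in> space M \<Longrightarrow> \<bar>h x\<bar> \<le> b"
    and n: "1 \<le> n"
  shows "(\<integral>\<^sup>+X. ennreal (((\<Sum>i<n. h (X i)) / real n - expectation h)\<^sup>2) \<partial>(\<Pi>\<^sub>M i\<in>{..<n}. M))
    \<le> (\<integral>\<^sup>+x. ennreal ((h x)\<^sup>2) \<partial>M) / ennreal (real n)"
proof -
  interpret P: product_sigma_finite "\<lambda>_::nat. M" ..
  interpret PP: prob_space "\<Pi>\<^sub>M i\<in>{..<n}. M"
    by (rule prob_space_PiM) (rule prob_space_axioms)
  let ?P = "\<Pi>\<^sub>M i\<in>{..<n}. M"
  define k where "k = (\<lambda>x. h x - expectation h)"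
  have k [measurable]: "k \<in> borel_measurable M"
    unfolding k_def by measurable
  have int_h: "integrable M h"
    by (rule integrable_const_bound[of _ b]) (use bound in auto)
  have "(h x)\<^sup>2 \<le> b\<^sup>2" if "x \<in> space M" for x
    using power_mono[OF bound[OF that], of 2] by simp
  then have int_h2: "integrable M (\<lambda>x. (h x)\<^sup>2)"
    by (intro integrable_const_bound[of _ "b\<^sup>2"]) auto
  have int_k: "integrable M k"
    unfolding k_def using int_h by simp
  have int_k2: "integrable M (\<lambda>x. (k x)\<^sup>2)"
    unfolding k_def power2_diff using int_h int_h2 by simp
  have mean_k: "expectation k = 0"
    unfolding k_def using int_h by (simp add: prob_space)
  have "expectation (\<lambda>x. (k x)\<^sup>2) = expectation (\<lambda>x. (h x)\<^sup>2) - (expectation h)\<^sup>2"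
    unfolding k_def by (rule variance_eq[OF int_h int_h2])
  then have var_le: "expectation (\<lambda>x. (k x)\<^sup>2) \<le> expectation (\<lambda>x. (h x)\<^sup>2)"
    by simp
  have cross: "integrable ?P (\<lambda>X. k (X i) * k (X j)) \<and>
      (\<integral>X. k (X i) * k (X j) \<partial>?P) = (if i = j then expectation (\<lambda>x. (k x)\<^sup>2) else 0)"
    if i: "i < n" and j: "j < n" for i j
  proof -
    \<comment> \<open>The product \<open>k (X i) * k (X j)\<close> in the form of a product over all coordinates,
      to which Fubini's theorem for finite products applies.\<close>
    define f where "f = (\<lambda>l x. (if l = i then k x else 1) * (if l = j then k x else 1))"
    have f_eq: "(\<Prod>l<n. f l (X l)) = k (X i) * k (X j)" for X
      using i j by (simp add: f_def prod.distrib prod.delta)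
    have f_int: "integrable M (f l)" for l
      using int_k int_k2 by (cases "l = i"; cases "l = j") (auto simp: f_def power2_eq_square)
    have "integrable ?P (\<lambda>X. \<Prod>l<n. f l (X l))"
      by (rule P.product_integrable_prod) (use f_int in auto)
    moreover have "(\<integral>X. (\<Prod>l<n. f l (X l)) \<partial>?P) = (\<Prod>l<n. expectation (f l))"
      by (rule P.product_integral_prod) (use f_int in auto)
    moreover have "(\<Prod>l<n. expectation (f l)) = (if i = j then expectation (\<lambda>x. (k x)\<^sup>2) else 0)"
    proof (cases "i = j")
      case True
      then have "(\<Prod>l<n. expectation (f l)) = (\<Prod>l<n. if l = i then expectation (\<lambda>x. (k x)\<^sup>2) else 1)"
        by (intro prod.cong) (auto simp: f_def power2_eq_square prob_space)
      then show ?thesis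
        using True i by (simp add: prod.delta)
    next
      case False
      then have "expectation (f i) = 0"
        using mean_k by (simp add: f_def)
      then have "(\<Prod>l<n. expectation (f l)) = 0"
        using i by (intro prod_zero) auto
      then show ?thesis
        using False by simp
    qed
    ultimately show ?thesis
      unfolding f_eq by simp
  qed
  have sq_eq: "(\<lambda>X. ((\<Sum>i<n. h (X i)) / real n - expectation h)\<^sup>2)
      = (\<lambda>X. (\<Sum>i<n. \<Sum>j<n. k (X i) * k (X j)) / (real n)\<^sup>2)"
  proof
    fix X :: "nat \<Rightarrow> 'a"
    have "(\<Sum>i<n. h (X i)) / real n - expectation h = (\<Sum>i<n. k (X i)) / real n"
      using n by (simp add: k_def sum_subtractf field_simps)
    then show "((\<Sum>i<n. h (X i)) / real n - expectation h)\<^sup>2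
        = (\<Sum>i<n. \<Sum>j<n. k (X i) * k (X j)) / (real n)\<^sup>2"
      by (simp add: power_divide power2_eq_square sum_product)
  qed
  have int_sq: "integrable ?P (\<lambda>X. ((\<Sum>i<n. h (X i)) / real n - expectation h)\<^sup>2)"
    unfolding sq_eq using cross by (intro integrable_divide_zero Bochner_Integration.integrable_sum) auto
  have "(\<integral>X. ((\<Sum>i<n. h (X i)) / real n - expectation h)\<^sup>2 \<partial>?P)
      = (\<Sum>i<n. \<Sum>j<n. if i = j then expectation (\<lambda>x. (k x)\<^sup>2) else 0) / (real n)\<^sup>2"
  proof -
    have "(\<integral>X. (\<Sum>i<n. \<Sum>j<n. k (X i) * k (X j)) \<partial>?P)
        = (\<Sum>i<n. \<integral>X. (\<Sum>j<n. k (X i) * k (X j)) \<partial>?P)"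
      using cross by (intro Bochner_Integration.integral_sum Bochner_Integration.integrable_sum) auto
    also have "\<dots> = (\<Sum>i<n. \<Sum>j<n. \<integral>X. k (X i) * k (X j) \<partial>?P)"
      using cross by (intro sum.cong refl Bochner_Integration.integral_sum) auto
    also have "\<dots> = (\<Sum>i<n. \<Sum>j<n. if i = j then expectation (\<lambda>x. (k x)\<^sup>2) else 0)"
      using cross by (intro sum.cong refl) auto
    finally show ?thesis
      unfolding sq_eq by simp
  qed
  also have "\<dots> = expectation (\<lambda>x. (k x)\<^sup>2) / real n"
    using n by (simp add: power2_eq_square)
  also have "\<dots> \<le> expectation (\<lambda>x. (h x)\<^sup>2) / real n"
    using var_le n by (simp add: divide_right_mono)
  finally have le: "(\<integral>X. ((\<Sum>i<n. h (X i)) / real n - expectation h)\<^sup>2 \<partial>?P)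
      \<le> expectation (\<lambda>x. (h x)\<^sup>2) / real n" .
  have "(\<integral>\<^sup>+X. ennreal (((\<Sum>i<n. h (X i)) / real n - expectation h)\<^sup>2) \<partial>?P)
      = ennreal (\<integral>X. ((\<Sum>i<n. h (X i)) / real n - expectation h)\<^sup>2 \<partial>?P)"
    by (rule nn_integral_eq_integral[OF int_sq]) simp
  also have "\<dots> \<le> ennreal (expectation (\<lambda>x. (h x)\<^sup>2) / real n)"
    by (rule ennreal_leI[OF le])
  also have "\<dots> = (\<integral>\<^sup>+x. ennreal ((h x)\<^sup>2) \<partial>M) / ennreal (real n)"
    using n by (subst nn_integral_eq_integral[OF int_h2]) (simp_all add: divide_ennreal)
  finally show ?thesis .
qed

section \<open>Gaussian integrals and subgaussian measures\<close>

text \<open>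
  Completing the square turns the integrand into a multiple of the normal density with mean
  \<open>u + b / (2 * a)\<close> and variance \<open>1 / (2 * a)\<close>.
\<close>

lemma gaussian_nn_integral:
  fixes a b u :: real
  assumes "0 < a"
  shows "(\<integral>\<^sup>+z. ennreal (exp (- a * (z - u)\<^sup>2 + b * (z - u))) \<partial>lborel)
    = ennreal (sqrt (pi / a) * exp (b\<^sup>2 / (4 * a)))"
proof -
  define s where "s = sqrt (1 / (2 * a))"
  define m where "m = u + b / (2 * a)"
  have s2: "s\<^sup>2 = 1 / (2 * a)" and s: "0 < s"
    using assms by (simp_all add: s_def)
  have root: "sqrt (2 * pi * s\<^sup>2) = sqrt (pi / a)" "0 < sqrt (pi / a)"
    using assms by (simp_all add: s2)
  have eq: "exp (- a * (z - u)\<^sup>2 + b * (z - u))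
      = (sqrt (pi / a) * exp (b\<^sup>2 / (4 * a))) * normal_density m s z" for z
  proof -
    have "- a * (z - u)\<^sup>2 + b * (z - u) = b\<^sup>2 / (4 * a) - a * ((z - u) - b / (2 * a))\<^sup>2"
      using assms by (simp add: power2_eq_square field_simps)
    also have "\<dots> = b\<^sup>2 / (4 * a) + (- (z - m)\<^sup>2 / (2 * s\<^sup>2))"
      using assms by (simp add: s2 m_def diff_diff_eq)
    finally have expo: "- a * (z - u)\<^sup>2 + b * (z - u) = b\<^sup>2 / (4 * a) + (- (z - m)\<^sup>2 / (2 * s\<^sup>2))" .
    have dens: "normal_density m s z = 1 / sqrt (pi / a) * exp (- (z - m)\<^sup>2 / (2 * s\<^sup>2))"
      unfolding normal_density_def root(1) ..
    have cancel: "r \<noteq> 0 \<Longrightarrow> e * e' = r * e * (1 / r * e')" for r e e' :: real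
      by simp
    have "sqrt (pi / a) \<noteq> 0"
      using root(2) by linarith
    from cancel[OF this] show ?thesis
      unfolding expo dens exp_add .
  qed
  have "(\<integral>\<^sup>+z. ennreal (normal_density m s z) \<partial>lborel) = 1"
    using s by (subst nn_integral_eq_integral) auto
  then show ?thesis
    using assms unfolding eq by (simp add: ennreal_mult nn_integral_cmult)
qed

lemma gaussian_nn_integral_vec:
  assumes "0 < a"
  shows "(\<integral>\<^sup>+z. ennreal (exp (\<Sum>i<d. - a * (z i - u i)\<^sup>2 + b i * (z i - u i))) \<partial>lborel_vec d)
    = ennreal (sqrt (pi / a) ^ d * exp ((\<Sum>i<d. (b i)\<^sup>2) / (4 * a)))"
proof -
  have "(\<integral>\<^sup>+z. ennreal (exp (\<Sum>i<d. - a * (z i - u i)\<^sup>2 + b i * (z i - u i))) \<partial>lborel_vec d)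
      = (\<integral>\<^sup>+z. ennreal (\<Prod>i<d. exp (- a * (z i - u i)\<^sup>2 + b i * (z i - u i))) \<partial>lborel_vec d)"
    by (simp add: exp_sum)
  also have "\<dots> = (\<Prod>i<d. \<integral>\<^sup>+t. ennreal (exp (- a * (t - u i)\<^sup>2 + b i * (t - u i))) \<partial>lborel)"
    by (rule nn_integral_lborel_vec_prod) auto
  also have "\<dots> = (\<Prod>i<d. ennreal (sqrt (pi / a) * exp ((b i)\<^sup>2 / (4 * a))))"
    using gaussian_nn_integral[OF assms] by simp
  also have "\<dots> = ennreal (\<Prod>i<d. sqrt (pi / a) * exp ((b i)\<^sup>2 / (4 * a)))"
    using assms by (intro prod_ennreal) auto
  also have "(\<Prod>i<d. sqrt (pi / a) * exp ((b i)\<^sup>2 / (4 * a)))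
      = sqrt (pi / a) ^ d * exp ((\<Sum>i<d. (b i)\<^sup>2) / (4 * a))"
    by (simp add: prod.distrib exp_sum sum_divide_distrib)
  finally show ?thesis .
qed

text \<open>
  Half of the exponential absorbs the factor \<open>t = \<parallel>z - m\<parallel>\<^sup>2\<close>, by \<open>t \<le> 2 / a * exp (a * t / 2)\<close>.
  What remains is a product over the coordinates, at the price of a constant to the power \<open>d\<close>.
\<close>

lemma gaussian_second_moment_le:
  assumes "0 < a"
  shows "(\<integral>\<^sup>+z. ennreal ((vnorm d (\<lambda>i. z i - m i))\<^sup>2 * exp (- a * (vnorm d (\<lambda>i. z i - m i))\<^sup>2)) \<partial>lborel_vec d)
    \<le> ennreal (2 / a * sqrt (2 * pi / a) ^ d)"
proof -
  have le: "t * exp (- a * t) \<le> 2 / a * exp (- (a / 2) * t)" if "0 \<le> t" for t :: real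
  proof -
    have "a / 2 * t \<le> exp (a / 2 * t)"
      using exp_ge_add_one_self[of "a / 2 * t"] by linarith
    then have "t \<le> 2 / a * exp (a / 2 * t)"
      using assms by (simp add: field_simps)
    then have "t * exp (- a * t) \<le> (2 / a * exp (a / 2 * t)) * exp (- a * t)"
      by (rule mult_right_mono) simp
    also have "\<dots> = 2 / a * exp (- (a / 2) * t)"
      by (simp add: exp_add[symmetric] field_simps)
    finally show ?thesis .
  qed
  have "(\<integral>\<^sup>+z. ennreal ((vnorm d (\<lambda>i. z i - m i))\<^sup>2 * exp (- a * (vnorm d (\<lambda>i. z i - m i))\<^sup>2)) \<partial>lborel_vec d)
      \<le> (\<integral>\<^sup>+z. ennreal (2 / a) * ennreal (exp (\<Sum>i<d. - (a / 2) * (z i - m i)\<^sup>2 + 0 * (z i - m i))) \<partial>lborel_vec d)"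
  proof (intro nn_integral_mono)
    fix z
    have "(\<Sum>i<d. - (a / 2) * (z i - m i)\<^sup>2 + 0 * (z i - m i)) = - (a / 2) * (vnorm d (\<lambda>i. z i - m i))\<^sup>2"
      by (simp add: vnorm_sq sum_distrib_left sum_negf sum_divide_distrib)
    then show "ennreal ((vnorm d (\<lambda>i. z i - m i))\<^sup>2 * exp (- a * (vnorm d (\<lambda>i. z i - m i))\<^sup>2))
        \<le> ennreal (2 / a) * ennreal (exp (\<Sum>i<d. - (a / 2) * (z i - m i)\<^sup>2 + 0 * (z i - m i)))"
      using le[of "(vnorm d (\<lambda>i. z i - m i))\<^sup>2"] assms
      by (simp add: ennreal_mult[symmetric] ennreal_leI)
  qed
  also have "\<dots> = ennreal (2 / a) * (\<integral>\<^sup>+z. ennreal (exp (\<Sum>i<d. - (a / 2) * (z i - m i)\<^sup>2 + 0 * (z i - m i))) \<partial>lborel_vec d)"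
    by (rule nn_integral_cmult) measurable
  also have "\<dots> = ennreal (2 / a) * ennreal (sqrt (pi / (a / 2)) ^ d * exp ((\<Sum>i<d. (0::real)\<^sup>2) / (4 * (a / 2))))"
    using assms by (subst gaussian_nn_integral_vec) auto
  also have "\<dots> = ennreal (2 / a * sqrt (2 * pi / a) ^ d)"
    using assms by (simp add: ennreal_mult[symmetric] mult.commute)
  finally show ?thesis .
qed

text \<open>
  The exponential of a squared norm is a Gaussian mixture of exponentials of linear forms:
  \<open>\<pi>\<^sup>d\<^sup>/\<^sup>2 exp (2 a \<parallel>y\<parallel>\<^sup>2) = \<integral> exp (\<surd>(8 a) \<langle>t, y\<rangle> - \<parallel>t\<parallel>\<^sup>2) dt\<close>.  Tonelli's theorem reduces its
  expectation to the exponential moments that the subgaussian property controls.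
\<close>

lemma subgaussian_exp_sq:
  assumes sub: "subgaussian d K \<mu>" and a: "0 < a" "8 * a * K\<^sup>2 \<le> 1"
  shows "(\<integral>\<^sup>+x. ennreal (exp (2 * a * (vnorm d (\<lambda>i. x i - (\<integral>y. y i \<partial>\<mu>)))\<^sup>2)) \<partial>\<mu>)
    \<le> ennreal (sqrt 2 ^ d)"
proof -
  define m where "m = (\<lambda>i. \<integral>y. y i \<partial>\<mu>)"
  from sub have "prob_space \<mu>" and sets_\<mu> [measurable_cong]: "sets \<mu> = sets (borel_vec d)"
    by (simp_all add: subgaussian_def P1_def)
  interpret prob_space \<mu> by fact
  interpret N: sigma_finite_measure "lborel_vec d" by (rule sigma_finite_lborel_vec)
  interpret \<mu>N: pair_sigma_finite \<mu> "lborel_vec d" ..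
  define r where "r = sqrt (8 * a)"
  have r2: "r\<^sup>2 = 8 * a"
    using a by (simp add: r_def)
  let ?E = "\<lambda>x t. exp (\<Sum>i<d. r * t i * (x i - m i)) * exp (- (vnorm d t)\<^sup>2)"
  have E: "?E x t = exp (\<Sum>i<d. - 1 * (t i - 0)\<^sup>2 + r * (x i - m i) * (t i - 0))" for x t
    by (simp add: vnorm_sq exp_add[symmetric] sum.distrib sum_negf sum_subtractf ac_simps)
  have mix: "ennreal (sqrt pi ^ d) * ennreal (exp (2 * a * (vnorm d (\<lambda>i. x i - m i))\<^sup>2))
      = (\<integral>\<^sup>+t. ennreal (?E x t) \<partial>lborel_vec d)" for x
    unfolding E
    by (subst gaussian_nn_integral_vec)
       (simp_all add: vnorm_sq power_mult_distrib r2 sum_distrib_left[symmetric] ennreal_mult[symmetric])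
  have mm: "(\<lambda>(x, t). ennreal (?E x t)) \<in> borel_measurable (\<mu> \<Otimes>\<^sub>M lborel_vec d)"
  proof -
    have f: "fst \<in> measurable (\<mu> \<Otimes>\<^sub>M lborel_vec d) (borel_vec d)" and s: "snd \<in> measurable (\<mu> \<Otimes>\<^sub>M lborel_vec d) (borel_vec d)"
      using measurable_fst[of \<mu> "lborel_vec d"] measurable_snd[of \<mu> "lborel_vec d"] sets_\<mu> by (simp_all cong: measurable_cong_sets)
    note [measurable] = measurable_component_compose[OF f] measurable_component_compose[OF s]
    show ?thesis
      unfolding split_beta' vnorm_sq by measurable
  qed
  have "ennreal (sqrt pi ^ d) * (\<integral>\<^sup>+x. ennreal (exp (2 * a * (vnorm d (\<lambda>i. x i - m i))\<^sup>2)) \<partial>\<mu>)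
      = (\<integral>\<^sup>+x. \<integral>\<^sup>+t. ennreal (?E x t) \<partial>lborel_vec d \<partial>\<mu>)"
    unfolding mix[symmetric] by (rule nn_integral_cmult[symmetric]) measurable
  also have "\<dots> = (\<integral>\<^sup>+t. \<integral>\<^sup>+x. ennreal (?E x t) \<partial>\<mu> \<partial>lborel_vec d)"
    by (rule \<mu>N.Fubini'[symmetric, OF mm])
  also have "\<dots> \<le> (\<integral>\<^sup>+t. ennreal (exp (\<Sum>i<d. - (1/2) * (t i - 0)\<^sup>2 + 0 * (t i - 0))) \<partial>lborel_vec d)"
  proof (rule nn_integral_mono)
    fix t
    have "(\<integral>\<^sup>+x. ennreal (?E x t) \<partial>\<mu>)
        = (\<integral>\<^sup>+x. ennreal (exp (\<Sum>i<d. r * t i * (x i - m i))) \<partial>\<mu>) * ennreal (exp (- (vnorm d t)\<^sup>2))"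
      by (subst nn_integral_multc[symmetric]) (simp_all add: ennreal_mult)
    also have "\<dots> \<le> ennreal (exp (1/2 * K\<^sup>2 * (vnorm d (\<lambda>i. r * t i))\<^sup>2)) * ennreal (exp (- (vnorm d t)\<^sup>2))"
      using sub unfolding subgaussian_def m_def by (intro mult_right_mono) auto
    also have "\<dots> = ennreal (exp ((4 * a * K\<^sup>2 - 1) * (vnorm d t)\<^sup>2))"
      by (simp add: vnorm_sq power_mult_distrib sum_distrib_left[symmetric] r2 ennreal_mult[symmetric]
          exp_add[symmetric] algebra_simps)
    also have "\<dots> \<le> ennreal (exp (- (1/2) * (vnorm d t)\<^sup>2))"
      using a by (intro ennreal_leI iffD2[OF exp_le_cancel_iff] mult_right_mono) auto
    also have "\<dots> = ennreal (exp (\<Sum>i<d. - (1/2) * (t i - 0)\<^sup>2 + 0 * (t i - 0)))"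
      by (simp add: vnorm_sq sum_negf sum_divide_distrib)
    finally show "(\<integral>\<^sup>+x. ennreal (?E x t) \<partial>\<mu>)
        \<le> ennreal (exp (\<Sum>i<d. - (1/2) * (t i - 0)\<^sup>2 + 0 * (t i - 0)))" .
  qed
  also have "\<dots> = ennreal (sqrt (pi / (1/2)) ^ d * exp ((\<Sum>i<d. (0::real)\<^sup>2) / (4 * (1/2))))"
    by (rule gaussian_nn_integral_vec) simp
  also have "\<dots> = ennreal (sqrt pi ^ d) * ennreal (sqrt 2 ^ d)"
    by (simp add: ennreal_mult[symmetric] real_sqrt_mult power_mult_distrib)
  finally show ?thesis
    unfolding m_def by (subst (asm) ennreal_mult_le_mult_iff) auto
qed

section \<open>The smoothed distance to the empirical measure\<close>

lemma empirical_eq_distr: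
  assumes n: "1 \<le> n" and X: "X \<in> {..<n} \<rightarrow> space (borel_vec d)"
  shows "empirical d n X = distr (uniform_count_measure {..<n}) (borel_vec d) X"
proof (rule measure_eqI)
  fix A assume "A \<in> sets (empirical d n X)"
  then have A: "A \<in> sets (borel_vec d)" by simp
  have Xm: "X \<in> measurable (uniform_count_measure {..<n}) (borel_vec d)"
    using X by (auto simp: measurable_def space_uniform_count_measure sets_uniform_count_measure)
  have "emeasure (distr (uniform_count_measure {..<n}) (borel_vec d) X) A
      = emeasure (uniform_count_measure {..<n}) {i\<in>{..<n}. X i \<in> A}"
    using A Xm by (subst emeasure_distr) (auto simp: space_uniform_count_measure intro!: arg_cong2[where f=emeasure])
  also have "\<dots> = ennreal (real (card {i\<in>{..<n}. X i \<in> A}) / real n)"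
    by (subst emeasure_uniform_count_measure) auto
  also have "\<dots> = (\<Sum>i<n. indicator A (X i)) / of_nat n"
    using n by (simp add: indicator_def sum.If_cases Int_def divide_ennreal[symmetric] ennreal_of_nat_eq_real_of_nat)
  also have "\<dots> = emeasure (empirical d n X) A"
    using A by (simp add: emeasure_empirical)
  finally show "emeasure (empirical d n X) A = emeasure (distr (uniform_count_measure {..<n}) (borel_vec d) X) A" ..
qed simp

lemma
  assumes n: "1 \<le> n" and X: "X \<in> {..<n} \<rightarrow> space (borel_vec d)"
  shows prob_space_empirical: "prob_space (empirical d n X)"
    and nn_integral_empirical: "f \<in> borel_measurable (borel_vec d) \<Longrightarrow>
      (\<integral>\<^sup>+x. f x \<partial>empirical d n X) = (\<Sum>i<n. f (X i)) / of_nat n"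
proof -
  have Xm: "X \<in> measurable (uniform_count_measure {..<n}) (borel_vec d)"
    using X by (auto simp: measurable_def space_uniform_count_measure sets_uniform_count_measure)
  have "prob_space (uniform_count_measure {..<n})"
    by (rule prob_space_uniform_count_measure) (use n in \<open>auto simp: lessThan_empty_iff\<close>)
  from prob_space.prob_space_distr[OF this Xm] show "prob_space (empirical d n X)"
    using empirical_eq_distr[OF assms] by simp
  assume f: "f \<in> borel_measurable (borel_vec d)"
  have "(\<integral>\<^sup>+x. f x \<partial>empirical d n X) = (\<integral>\<^sup>+i. f (X i) \<partial>uniform_count_measure {..<n})"
    unfolding empirical_eq_distr[OF assms] by (rule nn_integral_distr[OF Xm]) (use f in simp)
  also have "\<dots> = (\<Sum>i<n. ennreal (1 / real n) * f (X i))"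
    unfolding uniform_count_measure_def by (subst nn_integral_point_measure_finite) (auto simp: mult.commute)
  also have "\<dots> = (\<Sum>i<n. f (X i)) / of_nat n"
  proof -
    have "ennreal (1 / real n) = inverse (of_nat n)"
      using n by (simp add: inverse_ennreal ennreal_of_nat_eq_real_of_nat inverse_eq_divide)
    then show ?thesis
      by (simp add: sum_distrib_left[symmetric] divide_ennreal_def mult.commute)
  qed
  finally show "(\<integral>\<^sup>+x. f x \<partial>empirical d n X) = (\<Sum>i<n. f (X i)) / of_nat n" .
qed

lemma prob_space_conv_vec:
  assumes "prob_space \<mu>" "prob_space \<nu>" "sets \<mu> = sets (borel_vec d)" "sets \<nu> = sets (borel_vec d)"
  shows "prob_space (conv_vec d \<mu> \<nu>)"
proof -
  interpret \<mu>: prob_space \<mu> by fact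
  interpret \<nu>: prob_space \<nu> by fact
  interpret pair_prob_space \<mu> \<nu> ..
  show ?thesis
    unfolding conv_vec_def by (rule prob_space_distr) (rule measurable_vec_diff_sum(2)[OF assms(3,4)])
qed

lemma product_density_nonneg:
  "prob_density g \<Longrightarrow> 0 \<le> product_density d g x"
  by (simp add: product_density_def prob_density_def prod_nonneg)

lemma measurable_product_density:
  "prob_density g \<Longrightarrow> product_density d g \<in> borel_measurable (borel_vec d)"
  unfolding product_density_def
  using measurable_prod_component[of "\<lambda>x. x" "borel_vec d" d "\<lambda>_. g"] by (simp add: prob_density_def)

lemma nn_integral_product_density:
  assumes "prob_density g"
  shows "(\<integral>\<^sup>+x. ennreal (product_density d g x) \<partial>lborel_vec d) = 1"
  unfolding product_density_def
  using assms by (subst nn_integral_lborel_vec_prod) (auto simp: prob_density_def)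

lemma prob_space_product_law:
  assumes "prob_density g"
  shows "prob_space (product_law d g)"
proof (rule prob_spaceI)
  show "emeasure (product_law d g) (space (product_law d g)) = 1"
    unfolding product_law_def
    using measurable_product_density[OF assms] nn_integral_product_density[OF assms, of d]
    by (simp add: emeasure_density cong: nn_integral_cong_simp measurable_cong_sets)
qed

lemma sets_product_law [simp]: "sets (product_law d g) = sets (borel_vec d)"
  by (simp add: product_law_def)

text \<open>
  The density at \<open>z\<close> of the noise added to the point \<open>x\<close>.
\<close>

abbreviation shifted_density :: "nat \<Rightarrow> (real \<Rightarrow> real) \<Rightarrow> (nat \<Rightarrow> real) \<Rightarrow> (nat \<Rightarrow> real) \<Rightarrow> real" where
  "shifted_density d g z x \<equiv> product_density d g (\<lambda>i. z i - x i)"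

lemma measurable_shifted_density:
  assumes "prob_density g" "f \<in> measurable M (borel_vec d)" "h \<in> measurable M (borel_vec d)"
  shows "(\<lambda>w. shifted_density d g (f w) (h w)) \<in> borel_measurable M"
  unfolding product_density_def
proof (rule borel_measurable_prod)
  fix j assume "j \<in> {..<d}"
  then have [measurable]: "(\<lambda>w. f w j) \<in> borel_measurable M" "(\<lambda>w. h w j) \<in> borel_measurable M"
    using assms(2,3) by (auto intro: measurable_component_compose)
  have [measurable]: "g \<in> borel_measurable borel"
    using assms(1) by (simp add: prob_density_def)
  show "(\<lambda>w. g (f w j - h w j)) \<in> borel_measurable M"
    by measurable
qed

lemma conv_vec_product_law:
  assumes g: "prob_density g" and "prob_space \<mu>" "sets \<mu> = sets (borel_vec d)"
  shows "conv_vec d \<mu> (product_law d g)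
    = density (lborel_vec d) (\<lambda>z. \<integral>\<^sup>+x. ennreal (shifted_density d g z x) \<partial>\<mu>)"
proof -
  have "product_density d g (\<lambda>i\<in>{..<d}. z i - x i) = shifted_density d g z x" for z x
    by (simp add: product_density_def)
  then show ?thesis
    using conv_vec_density[OF assms(2,3), of "\<lambda>x. ennreal (product_density d g x)"]
      measurable_product_density[OF g, of d] prob_space_product_law[OF g, of d]
    by (simp add: product_law_def)
qed

lemma shifted_density_le:
  assumes g: "prob_density g" and b: "\<And>t. g t \<le> b"
  shows "shifted_density d g z x \<le> b ^ d"
proof -
  have "(\<Prod>j<d. g (z j - x j)) \<le> (\<Prod>j<d. b)"
    using g b by (intro prod_mono) (simp add: prob_density_def)
  then show ?thesis by (simp add: product_density_def)
qed

text \<open>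
  Both smoothed measures have Lebesgue densities, namely the empirical average and the mean of
  the shifted densities, so that the weighted total variation bound applies to them.
\<close>

lemma smooth_W1_empirical_le:
  assumes g: "prob_density g" and b: "\<And>t. g t \<le> b"
    and "prob_space \<mu>" and sets_\<mu>: "sets \<mu> = sets (borel_vec d)"
    and n: "1 \<le> n" and X: "X \<in> {..<n} \<rightarrow> space (borel_vec d)"
  shows "smooth_W1 d (product_law d g) (empirical d n X) \<mu>
    \<le> (\<integral>\<^sup>+z. ennreal (vnorm d (\<lambda>i. z i - m i) *
          \<bar>(\<Sum>i<n. shifted_density d g z (X i)) / real n - (\<integral>x. shifted_density d g z x \<partial>\<mu>)\<bar>) \<partial>lborel_vec d)"
proof -
  interpret \<mu>: prob_space \<mu> by fact
  let ?k = "shifted_density d g"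
  note k0 = product_density_nonneg[OF g]
  have kx [measurable]: "?k z \<in> borel_measurable (borel_vec d)" "(\<lambda>z. ?k z x) \<in> borel_measurable (borel_vec d)"
    if "z \<in> space (borel_vec d)" "x \<in> space (borel_vec d)" for z x
    using that by (auto intro!: measurable_shifted_density[OF g])
  have int: "integrable \<mu> (?k z)" if "z \<in> space (borel_vec d)" for z
  proof (rule \<mu>.integrable_const_bound[of _ "b ^ d"])
    show "?k z \<in> borel_measurable \<mu>"
      using that unfolding measurable_cong_sets[OF sets_\<mu> refl] by (intro measurable_shifted_density[OF g]) auto
    show "AE x in \<mu>. norm (?k z x) \<le> b ^ d"
      using shifted_density_le[OF g b] k0 by simp
  qed
  define p where "p = (\<lambda>z. (\<Sum>i<n. ?k z (X i)) / real n)"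
  define q where "q = (\<lambda>z. \<integral>x. ?k z x \<partial>\<mu>)"
  have p [measurable]: "p \<in> borel_measurable (borel_vec d)"
    unfolding p_def using Pi_mem[OF X]
    by (intro borel_measurable_divide borel_measurable_sum measurable_shifted_density[OF g]) auto
  have q [measurable]: "q \<in> borel_measurable (borel_vec d)"
    unfolding q_def
  proof (rule \<mu>.borel_measurable_lebesgue_integral)
    have "fst \<in> measurable (borel_vec d \<Otimes>\<^sub>M \<mu>) (borel_vec d)" "snd \<in> measurable (borel_vec d \<Otimes>\<^sub>M \<mu>) (borel_vec d)"
      using measurable_fst[of "borel_vec d" \<mu>] measurable_snd[of "borel_vec d" \<mu>] sets_\<mu> by (simp_all cong: measurable_cong_sets)
    then show "case_prod ?k \<in> borel_measurable (borel_vec d \<Otimes>\<^sub>M \<mu>)"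
      unfolding split_beta' by (rule measurable_shifted_density[OF g])
  qed
  have conv_emp: "conv_vec d (empirical d n X) (product_law d g) = density (lborel_vec d) p"
  proof -
    have "conv_vec d (empirical d n X) (product_law d g)
        = density (lborel_vec d) (\<lambda>z. \<integral>\<^sup>+x. ennreal (?k z x) \<partial>empirical d n X)"
      by (rule conv_vec_product_law[OF g prob_space_empirical[OF n X]]) simp_all
    also have "\<dots> = density (lborel_vec d) p"
    proof (rule density_cong)
      have eq: "(\<integral>\<^sup>+x. ennreal (?k z x) \<partial>empirical d n X) = ennreal (p z)" if "z \<in> space (borel_vec d)" for z
      proof -
        have "(\<integral>\<^sup>+x. ennreal (?k z x) \<partial>empirical d n X) = (\<Sum>i<n. ennreal (?k z (X i))) / of_nat n"
          using that
          by (intro nn_integral_empirical[OF n X] measurable_compose[OF _ measurable_ennreal]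
              measurable_shifted_density[OF g] measurable_const measurable_ident) simp_all
        also have "\<dots> = ennreal (p z)"
          using n by (simp add: p_def sum_ennreal k0 divide_ennreal sum_nonneg ennreal_of_nat_eq_real_of_nat)
        finally show ?thesis .
      qed
      then show "AE z in lborel_vec d. (\<integral>\<^sup>+x. ennreal (?k z x) \<partial>empirical d n X) = ennreal (p z)"
        by (intro AE_I2) simp
      show "(\<lambda>z. ennreal (p z)) \<in> borel_measurable (lborel_vec d)"
        by measurable
      then show "(\<lambda>z. \<integral>\<^sup>+x. ennreal (?k z x) \<partial>empirical d n X) \<in> borel_measurable (lborel_vec d)"
        using eq by (subst measurable_cong[where g="\<lambda>z. ennreal (p z)"]) simp_all
    qed
    finally show ?thesis .
  qed
  have conv_\<mu>: "conv_vec d \<mu> (product_law d g) = density (lborel_vec d) q"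
  proof -
    have "conv_vec d \<mu> (product_law d g)
        = density (lborel_vec d) (\<lambda>z. \<integral>\<^sup>+x. ennreal (?k z x) \<partial>\<mu>)"
      by (rule conv_vec_product_law[OF g \<open>prob_space \<mu>\<close> sets_\<mu>])
    also have "\<dots> = density (lborel_vec d) q"
    proof (rule density_cong)
      have eq: "(\<integral>\<^sup>+x. ennreal (?k z x) \<partial>\<mu>) = ennreal (q z)" if "z \<in> space (borel_vec d)" for z
        unfolding q_def by (rule nn_integral_eq_integral[OF int[OF that]]) (simp add: k0)
      then show "AE z in lborel_vec d. (\<integral>\<^sup>+x. ennreal (?k z x) \<partial>\<mu>) = ennreal (q z)"
        by (intro AE_I2) simp
      show "(\<lambda>z. ennreal (q z)) \<in> borel_measurable (lborel_vec d)"
        by measurable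
      then show "(\<lambda>z. \<integral>\<^sup>+x. ennreal (?k z x) \<partial>\<mu>) \<in> borel_measurable (lborel_vec d)"
        using eq by (subst measurable_cong[where g="\<lambda>z. ennreal (q z)"]) simp_all
    qed
    finally show ?thesis .
  qed
  have mass: "(\<integral>\<^sup>+z. ennreal (f z) \<partial>lborel_vec d) = 1"
    if "prob_space (density (lborel_vec d) f)" "f \<in> borel_measurable (borel_vec d)" for f :: "_ \<Rightarrow> real"
    using prob_space.emeasure_space_1[OF that(1)] that(2)
    by (simp add: emeasure_density cong: measurable_cong_sets nn_integral_cong_simp)
  have p1: "(\<integral>\<^sup>+z. ennreal (p z) \<partial>lborel_vec d) = 1"
    using prob_space_conv_vec[OF prob_space_empirical[OF n X] prob_space_product_law[OF g]
      sets_empirical sets_product_law] conv_emp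
    by (intro mass) simp_all
  have q1: "(\<integral>\<^sup>+z. ennreal (q z) \<partial>lborel_vec d) = 1"
    using prob_space_conv_vec[OF \<open>prob_space \<mu>\<close> prob_space_product_law[OF g]
      sets_\<mu> sets_product_law] conv_\<mu>
    by (intro mass) simp_all
  have p0: "0 \<le> p z" for z
    unfolding p_def using k0 by (simp add: sum_nonneg)
  have q0: "0 \<le> q z" for z
    unfolding q_def using k0 by simp
  show ?thesis
    unfolding smooth_W1_def conv_emp conv_\<mu>
    using W1_density_le[OF p q p0 q0 p1 q1] by (simp add: p_def q_def)
qed

lemma weighted_young:
  fixes A D w l :: real
  assumes "0 < w" "0 < l"
  shows "A * \<bar>D\<bar> \<le> l / 2 * (A\<^sup>2 * w) + 1 / (2 * l) * (1 / w * D\<^sup>2)"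
proof -
  have "0 \<le> (l * w * A - \<bar>D\<bar>)\<^sup>2 / (2 * l * w)"
    using assms by simp
  also have "\<dots> = l / 2 * (A\<^sup>2 * w) + 1 / (2 * l) * (1 / w * D\<^sup>2) - A * \<bar>D\<bar>"
    using assms by (simp add: power2_eq_square field_simps)
  finally show ?thesis by simp
qed

text \<open>
  The inner average over the samples is a variance of order \<open>1 / n\<close> at every point \<open>z\<close>.  To
  reach the square, the integrand \<open>A * \<bar>D\<bar>\<close> with \<open>A = \<parallel>z - m\<parallel>\<close> is split by Young's inequality with
  the Gaussian weight \<open>exp (- a * A\<^sup>2)\<close>, which makes \<open>A\<^sup>2\<close> integrable.  For the optimal \<open>l\<close> this is
  the Cauchy--Schwarz inequality for the double integral.
\<close>

lemma expected_smooth_W1_young: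
  assumes g: "prob_density g" and b: "\<And>t. g t \<le> b"
    and "prob_space \<mu>" and sets_\<mu> [measurable_cong]: "sets \<mu> = sets (borel_vec d)"
    and n: "1 \<le> n" and l: "0 < l"
  shows "expected_smooth_W1 d (product_law d g) \<mu> n
    \<le> ennreal (l / 2) * (\<integral>\<^sup>+z. ennreal ((vnorm d (\<lambda>i. z i - m i))\<^sup>2
            * exp (- a * (vnorm d (\<lambda>i. z i - m i))\<^sup>2)) \<partial>lborel_vec d)
      + ennreal (1 / (2 * l * real n)) * (\<integral>\<^sup>+x. \<integral>\<^sup>+z. ennreal ((shifted_density d g z x)\<^sup>2
            * exp (a * (vnorm d (\<lambda>i. z i - m i))\<^sup>2)) \<partial>lborel_vec d \<partial>\<mu>)"
    (is "_ \<le> ennreal (l / 2) * ?P + _ * ?Q")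
proof -
  interpret \<mu>: prob_space \<mu> by fact
  interpret \<mu>n: prob_space "\<Pi>\<^sub>M i\<in>{..<n}. \<mu>"
    by (rule prob_space_PiM) (rule \<mu>.prob_space_axioms)
  interpret N: sigma_finite_measure "lborel_vec d" by (rule sigma_finite_lborel_vec)
  interpret \<mu>N: pair_sigma_finite \<mu> "lborel_vec d" ..
  interpret \<mu>nN: pair_sigma_finite "\<Pi>\<^sub>M i\<in>{..<n}. \<mu>" "lborel_vec d" ..
  let ?\<mu>n = "\<Pi>\<^sub>M i\<in>{..<n}. \<mu>"
  let ?N = "lborel_vec d"
  let ?k = "shifted_density d g"
  let ?A = "\<lambda>z. vnorm d (\<lambda>i. z i - m i)"
  define q where "q = (\<lambda>z. \<integral>x. ?k z x \<partial>\<mu>)"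
  define D where "D = (\<lambda>X z. (\<Sum>i<n. ?k z (X i)) / real n - q z)"
  have km: "(\<lambda>p. ?k (snd p) (fst p)) \<in> borel_measurable (\<mu> \<Otimes>\<^sub>M ?N)"
    using measurable_fst[of \<mu> ?N] measurable_snd[of \<mu> ?N] sets_\<mu>
    by (intro measurable_shifted_density[OF g]) (simp_all cong: measurable_cong_sets)
  have q [measurable]: "q \<in> borel_measurable ?N"
    unfolding q_def
  proof (rule \<mu>.borel_measurable_lebesgue_integral)
    show "case_prod ?k \<in> borel_measurable (?N \<Otimes>\<^sub>M \<mu>)"
      using measurable_pair_swap[OF km] by (simp add: split_beta')
  qed
  have Dm [measurable]: "(\<lambda>p. D (fst p) (snd p)) \<in> borel_measurable (?\<mu>n \<Otimes>\<^sub>M ?N)"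
  proof -
    have "(\<lambda>p. ?k (snd p) (fst p i)) \<in> borel_measurable (?\<mu>n \<Otimes>\<^sub>M ?N)" if "i < n" for i
    proof (rule measurable_shifted_density[OF g])
      show "snd \<in> measurable (?\<mu>n \<Otimes>\<^sub>M ?N) (borel_vec d)"
        using measurable_snd[of ?\<mu>n ?N] by (simp cong: measurable_cong_sets)
      have "(\<lambda>X. X i) \<in> measurable ?\<mu>n \<mu>"
        using that by (intro measurable_component_singleton) simp
      then show "(\<lambda>p. fst p i) \<in> measurable (?\<mu>n \<Otimes>\<^sub>M ?N) (borel_vec d)"
        using measurable_compose[OF measurable_fst, of "\<lambda>X. X i" ?\<mu>n \<mu> ?N] sets_\<mu> by (simp cong: measurable_cong_sets)
    qed
    moreover have "(\<lambda>p. q (snd p)) \<in> borel_measurable (?\<mu>n \<Otimes>\<^sub>M ?N)"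
      by measurable
    ultimately show ?thesis
      unfolding D_def by (intro borel_measurable_diff borel_measurable_divide borel_measurable_sum) auto
  qed
  have DX [measurable]: "(\<lambda>z. D X z) \<in> borel_measurable ?N" if "X \<in> space ?\<mu>n" for X
    using measurable_compose[OF measurable_Pair1'[OF that, of ?N] Dm] by simp
  have Dz [measurable]: "(\<lambda>X. D X z) \<in> borel_measurable ?\<mu>n" if "z \<in> space ?N" for z
    using measurable_compose[OF measurable_Pair2'[OF that, of ?\<mu>n] Dm] by simp
  have "expected_smooth_W1 d (product_law d g) \<mu> n \<le> (\<integral>\<^sup>+X. \<integral>\<^sup>+z. ennreal (?A z * \<bar>D X z\<bar>) \<partial>?N \<partial>?\<mu>n)"
    unfolding expected_smooth_W1_def
  proof (rule nn_integral_mono)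
    fix X assume "X \<in> space ?\<mu>n"
    then have "X \<in> {..<n} \<rightarrow> space (borel_vec d)"
      using sets_eq_imp_space_eq[OF sets_\<mu>] by (auto simp: space_PiM PiE_iff)
    from smooth_W1_empirical_le[OF g b \<open>prob_space \<mu>\<close> sets_\<mu> n this, of m]
    show "smooth_W1 d (product_law d g) (empirical d n X) \<mu> \<le> (\<integral>\<^sup>+z. ennreal (?A z * \<bar>D X z\<bar>) \<partial>?N)"
      by (simp add: D_def q_def)
  qed
  also have "\<dots> \<le> (\<integral>\<^sup>+X. ennreal (l / 2) * ?P
      + ennreal (1 / (2 * l)) * (\<integral>\<^sup>+z. ennreal (exp (a * (?A z)\<^sup>2)) * ennreal ((D X z)\<^sup>2) \<partial>?N) \<partial>?\<mu>n)"
  proof (rule nn_integral_mono)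
    fix X assume X: "X \<in> space ?\<mu>n"
    note [measurable] = DX[OF X]
    have "(\<integral>\<^sup>+z. ennreal (?A z * \<bar>D X z\<bar>) \<partial>?N)
        \<le> (\<integral>\<^sup>+z. ennreal (l / 2) * ennreal ((?A z)\<^sup>2 * exp (- a * (?A z)\<^sup>2))
          + ennreal (1 / (2 * l)) * (ennreal (exp (a * (?A z)\<^sup>2)) * ennreal ((D X z)\<^sup>2)) \<partial>?N)"
    proof (rule nn_integral_mono)
      fix z
      have "?A z * \<bar>D X z\<bar> \<le> l / 2 * ((?A z)\<^sup>2 * exp (- a * (?A z)\<^sup>2))
          + 1 / (2 * l) * (1 / exp (- a * (?A z)\<^sup>2) * (D X z)\<^sup>2)"
        using l by (intro weighted_young) auto
      also have "1 / exp (- a * (?A z)\<^sup>2) = exp (a * (?A z)\<^sup>2)"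
        by (simp add: exp_minus field_simps)
      finally show "ennreal (?A z * \<bar>D X z\<bar>) \<le> ennreal (l / 2) * ennreal ((?A z)\<^sup>2 * exp (- a * (?A z)\<^sup>2))
          + ennreal (1 / (2 * l)) * (ennreal (exp (a * (?A z)\<^sup>2)) * ennreal ((D X z)\<^sup>2))"
        using l by (simp flip: ennreal_mult ennreal_plus)
    qed
    also have "\<dots> = ennreal (l / 2) * ?P
      + ennreal (1 / (2 * l)) * (\<integral>\<^sup>+z. ennreal (exp (a * (?A z)\<^sup>2)) * ennreal ((D X z)\<^sup>2) \<partial>?N)"
      by (subst nn_integral_add) (simp_all add: nn_integral_cmult)
    finally show "(\<integral>\<^sup>+z. ennreal (?A z * \<bar>D X z\<bar>) \<partial>?N) \<le> \<dots>" .
  qed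
  also have "\<dots> = ennreal (l / 2) * ?P
      + ennreal (1 / (2 * l)) * (\<integral>\<^sup>+X. \<integral>\<^sup>+z. ennreal (exp (a * (?A z)\<^sup>2)) * ennreal ((D X z)\<^sup>2) \<partial>?N \<partial>?\<mu>n)"
  proof -
    have "(\<lambda>X. \<integral>\<^sup>+z. ennreal (exp (a * (?A z)\<^sup>2)) * ennreal ((D X z)\<^sup>2) \<partial>?N) \<in> borel_measurable ?\<mu>n"
      by (rule N.borel_measurable_nn_integral) (use Dm in \<open>simp add: split_beta'\<close>)
    then show ?thesis
      by (simp add: nn_integral_add nn_integral_cmult \<mu>n.emeasure_space_1)
  qed
  also have "(\<integral>\<^sup>+X. \<integral>\<^sup>+z. ennreal (exp (a * (?A z)\<^sup>2)) * ennreal ((D X z)\<^sup>2) \<partial>?N \<partial>?\<mu>n)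
      = (\<integral>\<^sup>+z. \<integral>\<^sup>+X. ennreal (exp (a * (?A z)\<^sup>2)) * ennreal ((D X z)\<^sup>2) \<partial>?\<mu>n \<partial>?N)"
    by (rule \<mu>nN.Fubini'[symmetric]) (use Dm in \<open>simp add: split_beta'\<close>)
  also have "\<dots> \<le> (\<integral>\<^sup>+z. ennreal (1 / real n) * (\<integral>\<^sup>+x. ennreal ((?k z x)\<^sup>2 * exp (a * (?A z)\<^sup>2)) \<partial>\<mu>) \<partial>?N)"
  proof (rule nn_integral_mono)
    fix z assume z: "z \<in> space ?N"
    have kz [measurable]: "?k z \<in> borel_measurable \<mu>"
      using z unfolding measurable_cong_sets[OF sets_\<mu> refl] by (intro measurable_shifted_density[OF g]) auto
    have "(\<integral>\<^sup>+X. ennreal (exp (a * (?A z)\<^sup>2)) * ennreal ((D X z)\<^sup>2) \<partial>?\<mu>n)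
        = ennreal (exp (a * (?A z)\<^sup>2)) * (\<integral>\<^sup>+X. ennreal ((D X z)\<^sup>2) \<partial>?\<mu>n)"
      using Dz[OF z] by (simp add: nn_integral_cmult)
    also have "(\<integral>\<^sup>+X. ennreal ((D X z)\<^sup>2) \<partial>?\<mu>n) \<le> (\<integral>\<^sup>+x. ennreal ((?k z x)\<^sup>2) \<partial>\<mu>) / ennreal (real n)"
      unfolding D_def q_def
      using shifted_density_le[OF g b] product_density_nonneg[OF g]
      by (intro \<mu>.nn_integral_sq_empirical_deviation[OF kz _ n, of "b ^ d"]) simp
    also have "ennreal (exp (a * (?A z)\<^sup>2)) * ((\<integral>\<^sup>+x. ennreal ((?k z x)\<^sup>2) \<partial>\<mu>) / ennreal (real n))
        = ennreal (1 / real n) * (ennreal (exp (a * (?A z)\<^sup>2)) * (\<integral>\<^sup>+x. ennreal ((?k z x)\<^sup>2) \<partial>\<mu>))"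
      using n by (simp add: divide_ennreal_def inverse_ennreal inverse_eq_divide ac_simps)
    also have "ennreal (exp (a * (?A z)\<^sup>2)) * (\<integral>\<^sup>+x. ennreal ((?k z x)\<^sup>2) \<partial>\<mu>)
        = (\<integral>\<^sup>+x. ennreal ((?k z x)\<^sup>2 * exp (a * (?A z)\<^sup>2)) \<partial>\<mu>)"
      by (simp add: nn_integral_multc ennreal_mult mult.commute)
    finally show "(\<integral>\<^sup>+X. ennreal (exp (a * (?A z)\<^sup>2)) * ennreal ((D X z)\<^sup>2) \<partial>?\<mu>n)
        \<le> ennreal (1 / real n) * (\<integral>\<^sup>+x. ennreal ((?k z x)\<^sup>2 * exp (a * (?A z)\<^sup>2)) \<partial>\<mu>)"
      by (simp add: mult_left_mono)
  qed
  also have "\<dots> = ennreal (1 / real n) * (\<integral>\<^sup>+z. \<integral>\<^sup>+x. ennreal ((?k z x)\<^sup>2 * exp (a * (?A z)\<^sup>2)) \<partial>\<mu> \<partial>?N)"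
    by (rule nn_integral_cmult, rule \<mu>.borel_measurable_nn_integral)
       (use measurable_pair_swap[OF km] in \<open>simp add: split_beta'\<close>)
  also have "(\<integral>\<^sup>+z. \<integral>\<^sup>+x. ennreal ((?k z x)\<^sup>2 * exp (a * (?A z)\<^sup>2)) \<partial>\<mu> \<partial>?N) = ?Q"
    by (rule \<mu>N.Fubini') (use km in \<open>simp add: split_beta'\<close>)
  finally show ?thesis
    using n l by (simp add: ennreal_mult[symmetric] mult.assoc[symmetric] mult_left_mono add_left_mono)
qed

section \<open>The rate constant\<close>

text \<open>
  The envelope makes \<open>g\<^sup>2\<close> decay like \<open>exp (- t\<^sup>2 / (2 * \<sigma>\<^sup>2))\<close>, which beats the inverse weight because
  \<open>a \<le> 1 / (4 * \<sigma>\<^sup>2)\<close>: with \<open>z - m = (z - x) + y\<close> the integrand is a Gaussian in \<open>z - x\<close> whose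
  integral leaves only the factor \<open>exp (2 * a * \<parallel>y\<parallel>\<^sup>2)\<close>.
\<close>

lemma shifted_density_sq_integral_le:
  assumes g: "prob_density g" and s: "0 < \<sigma>" and c: "0 < c"
    and env: "\<And>t. g t \<le> c * exp (- t\<^sup>2 / (4 * \<sigma>\<^sup>2)) / sqrt (2 * pi * \<sigma>\<^sup>2)"
    and a: "0 < a" "a \<le> 1 / (4 * \<sigma>\<^sup>2)"
  shows "(\<integral>\<^sup>+z. ennreal ((shifted_density d g z x)\<^sup>2 * exp (a * (vnorm d (\<lambda>i. z i - m i))\<^sup>2)) \<partial>lborel_vec d)
    \<le> ennreal ((c\<^sup>2 / (\<sigma> * sqrt pi)) ^ d) * ennreal (exp (2 * a * (vnorm d (\<lambda>i. x i - m i))\<^sup>2))"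
proof -
  define \<gamma> where "\<gamma> = 1 / (2 * \<sigma>\<^sup>2) - a"
  define C where "C = c\<^sup>2 / (2 * pi * \<sigma>\<^sup>2)"
  define y where "y = (\<lambda>i. x i - m i)"
  let ?Y = "\<Sum>i<d. (y i)\<^sup>2"
  have \<gamma>: "1 / (4 * \<sigma>\<^sup>2) \<le> \<gamma>" "a \<le> \<gamma>" "0 < \<gamma>"
    using a s by (auto simp: \<gamma>_def field_simps)
  have C0: "0 \<le> C" by (simp add: C_def)
  have g_sq: "(g t)\<^sup>2 \<le> C * exp (- t\<^sup>2 / (2 * \<sigma>\<^sup>2))" for t
  proof -
    have "(g t)\<^sup>2 \<le> (c * exp (- t\<^sup>2 / (4 * \<sigma>\<^sup>2)) / sqrt (2 * pi * \<sigma>\<^sup>2))\<^sup>2"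
      using env[of t] g by (intro power_mono) (auto simp: prob_density_def)
    also have "\<dots> = C * (exp (- t\<^sup>2 / (4 * \<sigma>\<^sup>2)))\<^sup>2"
      using s by (simp add: C_def power_divide power_mult_distrib)
    also have "(exp (- t\<^sup>2 / (4 * \<sigma>\<^sup>2)))\<^sup>2 = exp (- t\<^sup>2 / (2 * \<sigma>\<^sup>2))"
      by (simp add: exp_double[symmetric])
    finally show ?thesis .
  qed
  have pointwise: "(shifted_density d g z x)\<^sup>2 * exp (a * (vnorm d (\<lambda>i. z i - m i))\<^sup>2)
      \<le> (C ^ d * exp (a * ?Y)) * exp (\<Sum>i<d. - \<gamma> * (z i - x i)\<^sup>2 + (2 * a * y i) * (z i - x i))" for z
  proof -
    have "(shifted_density d g z x)\<^sup>2 = (\<Prod>i<d. (g (z i - x i))\<^sup>2)"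
      by (simp add: product_density_def prod_power_distrib)
    also have "\<dots> \<le> (\<Prod>i<d. C * exp (- (z i - x i)\<^sup>2 / (2 * \<sigma>\<^sup>2)))"
      using g_sq by (intro prod_mono) auto
    also have "\<dots> = C ^ d * exp (\<Sum>i<d. - (z i - x i)\<^sup>2 / (2 * \<sigma>\<^sup>2))"
      by (simp add: prod.distrib exp_sum)
    finally have "(shifted_density d g z x)\<^sup>2 * exp (a * (vnorm d (\<lambda>i. z i - m i))\<^sup>2)
        \<le> C ^ d * exp (\<Sum>i<d. - (z i - x i)\<^sup>2 / (2 * \<sigma>\<^sup>2)) * exp (a * (vnorm d (\<lambda>i. z i - m i))\<^sup>2)"
      by (rule mult_right_mono) simp
    also have "\<dots> = C ^ d * exp (\<Sum>i<d. - (z i - x i)\<^sup>2 / (2 * \<sigma>\<^sup>2) + a * (z i - m i)\<^sup>2)"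
      by (simp only: vnorm_sq sum_distrib_left sum.distrib exp_add mult.assoc)
    also have "(\<Sum>i<d. - (z i - x i)\<^sup>2 / (2 * \<sigma>\<^sup>2) + a * (z i - m i)\<^sup>2)
        = (\<Sum>i<d. a * (y i)\<^sup>2 + (- \<gamma> * (z i - x i)\<^sup>2 + (2 * a * y i) * (z i - x i)))"
    proof (rule sum.cong[OF refl])
      fix i
      have "z i - m i = (z i - x i) + y i" by (simp add: y_def)
      then show "- (z i - x i)\<^sup>2 / (2 * \<sigma>\<^sup>2) + a * (z i - m i)\<^sup>2
          = a * (y i)\<^sup>2 + (- \<gamma> * (z i - x i)\<^sup>2 + (2 * a * y i) * (z i - x i))"
        by (simp only: \<gamma>_def power2_sum) (simp add: algebra_simps)
    qed
    also have "C ^ d * exp \<dots> = (C ^ d * exp (a * ?Y)) * exp (\<Sum>i<d. - \<gamma> * (z i - x i)\<^sup>2 + (2 * a * y i) * (z i - x i))"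
      by (simp only: sum.distrib[of "\<lambda>i. a * (y i)\<^sup>2"] exp_add sum_distrib_left mult.assoc)
    finally show ?thesis .
  qed
  have "(\<integral>\<^sup>+z. ennreal ((shifted_density d g z x)\<^sup>2 * exp (a * (vnorm d (\<lambda>i. z i - m i))\<^sup>2)) \<partial>lborel_vec d)
      \<le> (\<integral>\<^sup>+z. ennreal (C ^ d * exp (a * ?Y))
          * ennreal (exp (\<Sum>i<d. - \<gamma> * (z i - x i)\<^sup>2 + (2 * a * y i) * (z i - x i))) \<partial>lborel_vec d)"
    using pointwise C0 by (intro nn_integral_mono) (simp add: ennreal_mult[symmetric] ennreal_leI)
  also have "\<dots> = ennreal (C ^ d * exp (a * ?Y))
      * (\<integral>\<^sup>+z. ennreal (exp (\<Sum>i<d. - \<gamma> * (z i - x i)\<^sup>2 + (2 * a * y i) * (z i - x i))) \<partial>lborel_vec d)"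
    by (rule nn_integral_cmult) measurable
  also have "\<dots> = ennreal (C ^ d * exp (a * ?Y))
      * ennreal (sqrt (pi / \<gamma>) ^ d * exp ((\<Sum>i<d. (2 * a * y i)\<^sup>2) / (4 * \<gamma>)))"
    by (subst gaussian_nn_integral_vec[OF \<gamma>(3)]) (rule refl)
  also have "\<dots> = ennreal (C ^ d * exp (a * ?Y) * (sqrt (pi / \<gamma>) ^ d * exp ((\<Sum>i<d. (2 * a * y i)\<^sup>2) / (4 * \<gamma>))))"
    using C0 \<gamma> by (intro ennreal_mult[symmetric]) auto
  also have "\<dots> \<le> ennreal (C ^ d * exp (a * ?Y) * ((2 * \<sigma> * sqrt pi) ^ d * exp (a * ?Y)))"
  proof (intro ennreal_leI mult_left_mono mult_mono power_mono)
    have "pi / \<gamma> \<le> pi / (1 / (4 * \<sigma>\<^sup>2))"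
      using \<gamma> s by (intro divide_left_mono) auto
    then have "sqrt (pi / \<gamma>) \<le> sqrt ((2 * \<sigma>)\<^sup>2 * pi)"
      by (intro real_sqrt_le_mono) (simp add: power2_eq_square mult.commute)
    then show "sqrt (pi / \<gamma>) \<le> 2 * \<sigma> * sqrt pi"
      using s by (simp add: real_sqrt_mult)
    have "(\<Sum>i<d. (2 * a * y i)\<^sup>2) = 4 * a * a * ?Y"
      by (simp add: power_mult_distrib sum_distrib_left power2_eq_square[of a] mult.assoc)
    then have "(\<Sum>i<d. (2 * a * y i)\<^sup>2) / (4 * \<gamma>) = (a / \<gamma>) * (a * ?Y)"
      by simp
    also have "\<dots> \<le> 1 * (a * ?Y)"
      using \<gamma> a by (intro mult_right_mono) (auto simp: sum_nonneg)
    finally show "exp ((\<Sum>i<d. (2 * a * y i)\<^sup>2) / (4 * \<gamma>)) \<le> exp (a * ?Y)"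
      by simp
  qed (use C0 \<gamma> s in auto)
  also have "C ^ d * exp (a * ?Y) * ((2 * \<sigma> * sqrt pi) ^ d * exp (a * ?Y))
      = (C * (2 * \<sigma> * sqrt pi)) ^ d * (exp (a * ?Y) * exp (a * ?Y))"
    by (simp only: power_mult_distrib ac_simps)
  also have "C * (2 * \<sigma> * sqrt pi) = c\<^sup>2 / (\<sigma> * sqrt pi)"
  proof -
    have "C * (2 * \<sigma> * sqrt pi) * (\<sigma> * sqrt pi) = C * (2 * \<sigma>\<^sup>2 * (sqrt pi * sqrt pi))"
      by (simp only: power2_eq_square ac_simps)
    also have "\<dots> = c\<^sup>2"
      using s by (simp add: C_def)
    finally show ?thesis
      using s by (simp only: eq_divide_eq) simp
  qed
  also have "exp (a * ?Y) * exp (a * ?Y) = exp (2 * a * (vnorm d (\<lambda>i. x i - m i))\<^sup>2)"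
    by (simp add: vnorm_sq y_def exp_add[symmetric])
  finally show ?thesis
    using s by (simp add: ennreal_mult)
qed

lemma sqrt_power_eq_powr:
  fixes x :: real
  assumes "0 < x"
  shows "sqrt x ^ d = x powr (real d / 2)"
proof -
  have "sqrt x ^ d = (x powr (1/2)) powr real d"
    using assms by (subst powr_realpow) (simp_all add: powr_half_sqrt)
  then show ?thesis
    by (simp only: powr_powr) simp
qed

lemma rate_const_ge:
  assumes s: "0 < \<sigma>" and K: "0 < K" and c: "0 < c" and d: "1 \<le> d"
  shows "4 * (\<sigma> + K) * (3 * c * sqrt ((\<sigma> + K) / \<sigma>)) ^ d \<le> rate_const (12 * c) \<sigma> d K"
proof -
  define R where "R = 1 + K / \<sigma>"
  have R: "(\<sigma> + K) / \<sigma> = R" "\<sigma> + K = \<sigma> * R" "1 < R"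
    using s K by (simp_all add: R_def add_divide_distrib distrib_left)
  have "4 * (\<sigma> + K) * (3 * c * sqrt ((\<sigma> + K) / \<sigma>)) ^ d = 4 * (3 * c) ^ d * (\<sigma> * (sqrt R ^ d * R))"
    unfolding R(1,2) by (simp add: power_mult_distrib)
  also have "sqrt R ^ d * R = R powr (real d / 2 + 1)"
    using R(3) by (simp add: powr_add sqrt_power_eq_powr)
  also have "4 * (3 * c) ^ d * (\<sigma> * R powr (real d / 2 + 1)) \<le> (12 * c) ^ d * (\<sigma> * R powr (real d / 2 + 1))"
  proof (rule mult_right_mono)
    have "(4::real) ^ 1 \<le> 4 ^ d" using d by (intro power_increasing) auto
    then have "4 * (3 * c) ^ d \<le> 4 ^ d * (3 * c) ^ d"
      using c by (intro mult_right_mono) auto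
    also have "\<dots> = (4 * (3 * c)) ^ d"
      by (simp only: power_mult_distrib)
    finally show "4 * (3 * c) ^ d \<le> (12 * c) ^ d"
      by simp
  qed (use s in simp)
  also have "\<dots> \<le> (12 * c) ^ d * (\<sigma> * R powr (real d / 2 + 1)) * (sqrt (2 * real d) * exp (3 * real d / 16))"
  proof -
    have "1 * 1 \<le> sqrt (2 * real d) * exp (3 * real d / 16)"
      using d by (intro mult_mono) auto
    moreover have "0 \<le> (12 * c) ^ d * (\<sigma> * R powr (real d / 2 + 1))"
      using s c by simp
    ultimately show ?thesis
      using mult_left_mono[of 1 "sqrt (2 * real d) * exp (3 * real d / 16)"
          "(12 * c) ^ d * (\<sigma> * R powr (real d / 2 + 1))"] by (simp only: mult_1 mult_1_right)
  qed
  also have "\<dots> = rate_const (12 * c) \<sigma> d K"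
    by (simp add: rate_const_def R_def)
  finally show ?thesis .
qed

text \<open>
  The weight \<open>a = 1 / (8 * (\<sigma> + K)\<^sup>2)\<close> is small enough for both conditions on it: the
  integrability of the squared noise density against the inverse weight, and the bound
  on \<open>exp (2 * a * \<parallel>X - m\<parallel>\<^sup>2)\<close> for the \<open>K\<close>-subgaussian \<open>X\<close>.  As \<open>a\<close> is of order \<open>(\<sigma> + K)\<^sup>-\<^sup>2\<close>,
  the weight has mass \<open>(\<sigma> + K)\<^sup>d\<close> and second moment \<open>(\<sigma> + K)\<^sup>d\<^sup>+\<^sup>2\<close> up to factors \<open>C ^ d\<close>; the square root of the latter gives
  the power \<open>d / 2 + 1\<close>.  All other dimension-dependent factors go into the power \<open>(12 * c) ^ d\<close>.
\<close>

lemma expected_smooth_W1_le: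
  assumes g: "prob_density g" and s: "0 < \<sigma>" and c: "0 < c"
    and env: "\<And>t. g t \<le> c * exp (- t\<^sup>2 / (4 * \<sigma>\<^sup>2)) / sqrt (2 * pi * \<sigma>\<^sup>2)"
    and K: "0 < K" and sub: "subgaussian d K \<mu>" and d: "1 \<le> d" and n: "1 \<le> n"
  shows "expected_smooth_W1 d (product_law d g) \<mu> n
    \<le> ennreal (rate_const (12 * c) \<sigma> d K * real n powr (-1/2))"
proof -
  from sub have \<mu>: "prob_space \<mu>" "sets \<mu> = sets (borel_vec d)"
    by (simp_all add: subgaussian_def P1_def)
  define S where "S = \<sigma> + K"
  define a where "a = 1 / (8 * S\<^sup>2)"
  define m where "m = (\<lambda>i. \<integral>y. y i \<partial>\<mu>)"
  have S: "0 < S" "\<sigma> \<le> S" "K \<le> S" using s K by (simp_all add: S_def)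
  have S2: "\<sigma>\<^sup>2 \<le> S\<^sup>2" "K\<^sup>2 \<le> S\<^sup>2"
    using S s K by (simp_all add: power_mono)
  have a1: "0 < a"
    using S by (simp add: a_def)
  have "4 * \<sigma>\<^sup>2 \<le> 8 * S\<^sup>2"
    using S2(1) zero_le_power2[of S] by linarith
  then have a2: "a \<le> 1 / (4 * \<sigma>\<^sup>2)"
    unfolding a_def using S s by (intro divide_left_mono) auto
  have "8 * a * K\<^sup>2 = K\<^sup>2 / S\<^sup>2"
    using S by (simp add: a_def)
  also have "\<dots> \<le> 1"
    using S S2(2) by (subst divide_le_eq_1_pos) auto
  finally have a3: "8 * a * K\<^sup>2 \<le> 1" .
  note a = a1 a2 a3
  define p where "p = 4 * S * sqrt pi"
  define q where "q = c\<^sup>2 / (\<sigma> * sqrt pi) * sqrt 2"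
  define r where "r = 3 * c * sqrt (S / \<sigma>)"
  have p: "0 < p" and q: "0 < q" and r: "0 < r"
    using S s c by (simp_all add: p_def q_def r_def)
  let ?P = "\<integral>\<^sup>+z. ennreal ((vnorm d (\<lambda>i. z i - m i))\<^sup>2 * exp (- a * (vnorm d (\<lambda>i. z i - m i))\<^sup>2)) \<partial>lborel_vec d"
  let ?Q = "\<integral>\<^sup>+x. \<integral>\<^sup>+z. ennreal ((shifted_density d g z x)\<^sup>2 * exp (a * (vnorm d (\<lambda>i. z i - m i))\<^sup>2)) \<partial>lborel_vec d \<partial>\<mu>"
  have P: "?P \<le> ennreal (16 * S\<^sup>2 * p ^ d)"
  proof -
    have "2 * pi / a = (4 * S)\<^sup>2 * pi"
      using S by (simp add: a_def power2_eq_square)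
    then have "sqrt (2 * pi / a) = p"
      using S by (simp add: p_def real_sqrt_mult)
    moreover have "2 / a = 16 * S\<^sup>2"
      using S by (simp add: a_def)
    ultimately show ?thesis
      using gaussian_second_moment_le[OF a(1), of d m] by simp
  qed
  have Q: "?Q \<le> ennreal (q ^ d)"
  proof -
    have "?Q \<le> (\<integral>\<^sup>+x. ennreal ((c\<^sup>2 / (\<sigma> * sqrt pi)) ^ d) * ennreal (exp (2 * a * (vnorm d (\<lambda>i. x i - m i))\<^sup>2)) \<partial>\<mu>)"
      by (intro nn_integral_mono shifted_density_sq_integral_le[OF g s c env a(1,2)])
    also have "\<dots> = ennreal ((c\<^sup>2 / (\<sigma> * sqrt pi)) ^ d) * (\<integral>\<^sup>+x. ennreal (exp (2 * a * (vnorm d (\<lambda>i. x i - m i))\<^sup>2)) \<partial>\<mu>)"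
      by (rule nn_integral_cmult) (simp add: measurable_cong_sets[OF \<mu>(2) refl])
    also have "\<dots> \<le> ennreal ((c\<^sup>2 / (\<sigma> * sqrt pi)) ^ d) * ennreal (sqrt 2 ^ d)"
      unfolding m_def by (intro mult_left_mono subgaussian_exp_sq[OF sub a(1,3)]) simp
    also have "\<dots> = ennreal ((c\<^sup>2 / (\<sigma> * sqrt pi)) ^ d * sqrt 2 ^ d)"
      using s by (intro ennreal_mult[symmetric]) auto
    also have "\<dots> = ennreal (q ^ d)"
      by (simp only: q_def power_mult_distrib)
    finally show ?thesis .
  qed
  have pq: "p * q \<le> r\<^sup>2"
  proof -
    have "p * q = 4 * sqrt 2 * (c\<^sup>2 * (S / \<sigma>)) * (sqrt pi / sqrt pi)"
      by (simp only: p_def q_def times_divide_eq_right times_divide_eq_left times_divide_times_eq divide_divide_eq_left ac_simps)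
    also have "\<dots> = 4 * sqrt 2 * (c\<^sup>2 * (S / \<sigma>))"
      by simp
    also have "\<dots> \<le> 9 * (c\<^sup>2 * (S / \<sigma>))"
    proof (rule mult_right_mono)
      have "sqrt 2 \<le> 9 / 4" by (rule real_le_lsqrt) (simp_all add: power2_eq_square)
      then show "4 * sqrt 2 \<le> 9" by simp
    qed (use S s in simp)
    also have "\<dots> = r\<^sup>2"
      using S s by (simp add: r_def power_mult_distrib)
    finally show ?thesis .
  qed
  define N where "N = sqrt (real n)"
  have N: "0 < N" "real n = N\<^sup>2" using n by (simp_all add: N_def)
  \<comment> \<open>This choice balances the two terms of Young's inequality.\<close>
  define l where "l = r ^ d / (4 * S * p ^ d * N)"
  have l: "0 < l" using S p r N by (simp add: l_def)
  obtain b where b: "\<And>t. g t \<le> b"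
  proof
    fix t
    have "c * exp (- t\<^sup>2 / (4 * \<sigma>\<^sup>2)) / sqrt (2 * pi * \<sigma>\<^sup>2) \<le> c * 1 / sqrt (2 * pi * \<sigma>\<^sup>2)"
      using c by (intro divide_right_mono mult_left_mono) auto
    then show "g t \<le> c / sqrt (2 * pi * \<sigma>\<^sup>2)"
      using env[of t] by simp
  qed
  have "expected_smooth_W1 d (product_law d g) \<mu> n
      \<le> ennreal (l / 2) * ?P + ennreal (1 / (2 * l * real n)) * ?Q"
    by (rule expected_smooth_W1_young[OF g b \<mu> n l])
  also have "\<dots> \<le> ennreal (l / 2) * ennreal (16 * S\<^sup>2 * p ^ d) + ennreal (1 / (2 * l * real n)) * ennreal (q ^ d)"
    by (intro add_mono mult_left_mono P Q) simp_all
  also have "\<dots> = ennreal (l / 2 * (16 * S\<^sup>2 * p ^ d) + 1 / (2 * l * real n) * q ^ d)"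
    using l S p q by (simp add: ennreal_mult[symmetric] ennreal_plus[symmetric] del: ennreal_plus)
  also have "\<dots> \<le> ennreal (rate_const (12 * c) \<sigma> d K * real n powr (-1/2))"
  proof (rule ennreal_leI)
    have "l / 2 * (16 * S\<^sup>2 * p ^ d) = 2 * S * r ^ d / N"
      using S p N by (simp add: l_def power2_eq_square)
    moreover have "1 / (2 * l * real n) * q ^ d = 2 * S * (p * q) ^ d / (r ^ d * N)"
      using S p q r N by (simp add: l_def power2_eq_square power_mult_distrib)
    moreover have "2 * S * (p * q) ^ d / (r ^ d * N) \<le> 2 * S * (r ^ d * r ^ d) / (r ^ d * N)"
      using S r N p q power_mono[OF pq, of d]
      by (intro divide_right_mono mult_left_mono) (simp_all add: power_mult_distrib power2_eq_square)
    moreover have "2 * S * (r ^ d * r ^ d) / (r ^ d * N) = 2 * S * r ^ d / N"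
      using r by simp
    ultimately have "l / 2 * (16 * S\<^sup>2 * p ^ d) + 1 / (2 * l * real n) * q ^ d
        \<le> 2 * S * r ^ d / N + 2 * S * r ^ d / N"
      by linarith
    also have "\<dots> = 4 * S * r ^ d / N"
      by simp
    also have "\<dots> \<le> rate_const (12 * c) \<sigma> d K / N"
      using rate_const_ge[OF s K c d] N by (intro divide_right_mono) (simp_all add: S_def r_def)
    also have "\<dots> = rate_const (12 * c) \<sigma> d K * (1 / N)"
      by simp
    also have "1 / N = real n powr (-1/2)"
      using powr_minus[of "real n" "1/2"] n by (simp add: N_def powr_half_sqrt inverse_eq_divide)
    finally show "l / 2 * (16 * S\<^sup>2 * p ^ d) + 1 / (2 * l * real n) * q ^ d
        \<le> rate_const (12 * c) \<sigma> d K * real n powr (-1/2)" .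
  qed
  finally show ?thesis .
qed

section \<open>The densities to which the bound applies\<close>

text \<open>
  A monotone density is at most its average over the unit interval that ends at \<open>t\<close> and lies
  towards zero.  The mass of that interval obeys the Chernoff bound with parameter \<open>t / \<sigma>\<^sup>2\<close>, which
  is \<open>exp (- t\<^sup>2 / (2 * \<sigma>\<^sup>2))\<close> up to a factor \<open>exp (L * \<bar>t\<bar>)\<close> due to the mean and to the length of the
  interval.  The quadratic \<open>\<delta> * t\<^sup>2\<close> absorbs this factor.  For \<open>\<bar>t\<bar> \<le> 1\<close>, boundedness suffices.
\<close>

lemma subgaussian_density_envelope:
  assumes sub: "subgaussian_density \<sigma> g" and bdd: "bounded (range g)" and dec: "decreasing_from_zero g"
    and s: "0 < \<sigma>" and \<delta>: "0 < \<delta>"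
  obtains c where "0 < c"
    "\<And>t. g t \<le> c * exp (\<delta> * t\<^sup>2) * (exp (- t\<^sup>2 / (2 * \<sigma>\<^sup>2)) / sqrt (2 * pi * \<sigma>\<^sup>2))"
proof -
  from sub have g: "prob_density g" by (simp add: subgaussian_density_def)
  then have gm [measurable]: "g \<in> borel_measurable borel" and g0: "\<And>x. 0 \<le> g x"
    by (simp_all add: prob_density_def)
  define M where "M = density lborel (\<lambda>x. ennreal (g x))"
  define m where "m = (\<integral>y. y \<partial>M)"
  have mgf: "(\<integral>\<^sup>+x. ennreal (g x) * ennreal (exp (a * (x - m))) \<partial>lborel) \<le> ennreal (exp (1/2 * \<sigma>\<^sup>2 * a\<^sup>2))" for a
  proof -
    have "(\<integral>\<^sup>+x. ennreal (exp (a * (x - m))) \<partial>M) \<le> ennreal (exp (1/2 * \<sigma>\<^sup>2 * a\<^sup>2))"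
      using sub by (simp add: subgaussian_density_def Let_def M_def m_def)
    then show ?thesis
      unfolding M_def by (subst (asm) nn_integral_density) auto
  qed
  obtain b where b: "\<And>x. g x \<le> b"
    using bdd by (auto simp: bounded_iff) (metis abs_le_D1)
  have b0: "0 \<le> b" using g0[of 0] b[of 0] by simp
  define L where "L = (\<bar>m\<bar> + 1) / \<sigma>\<^sup>2"
  define c0 where "c0 = exp (L\<^sup>2 / (4 * \<delta>)) + b * exp (1 / (2 * \<sigma>\<^sup>2))"
  have tail: "g t \<le> exp (L\<^sup>2 / (4 * \<delta>)) * exp (\<delta> * t\<^sup>2) * exp (- t\<^sup>2 / (2 * \<sigma>\<^sup>2))" if t: "1 \<le> \<bar>t\<bar>" for t
  proof -
    \<comment> \<open>The interval has the end points \<open>t\<close> and \<open>u\<close>, on the same side of zero; \<open>a\<close> has the sign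
      of \<open>t\<close>, so that \<open>exp (a * (x - u)) \<ge> 1\<close> on it.\<close>
    define a where "a = t / \<sigma>\<^sup>2"
    define u where "u = t - sgn t"
    define l where "l = min t u"
    have near: "g t \<le> g x" "0 \<le> a * (x - u)" if "x \<in> {l..l + 1}" for x
    proof -
      have "(0 \<le> x \<and> x \<le> t \<and> u \<le> x \<and> 0 \<le> t) \<or> (t \<le> x \<and> x \<le> 0 \<and> x \<le> u \<and> t \<le> 0)"
        using t that by (auto simp: l_def u_def sgn_if min_def abs_if split: if_splits)
      then show "g t \<le> g x" "0 \<le> a * (x - u)"
        using dec s by (auto simp: decreasing_from_zero_def a_def zero_le_divide_iff intro: mult_nonneg_nonneg mult_nonpos_nonpos)
    qed
    have "ennreal (g t) = (\<integral>\<^sup>+x. ennreal (g t) * indicator {l..l + 1} x \<partial>lborel)"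
      by (subst nn_integral_cmult_indicator) auto
    also have "\<dots> \<le> (\<integral>\<^sup>+x. ennreal (exp (a * (m - u))) * (ennreal (g x) * ennreal (exp (a * (x - m)))) \<partial>lborel)"
    proof (rule nn_integral_mono)
      fix x
      have "g t * 1 \<le> g x * exp (a * (x - u))" if "x \<in> {l..l + 1}"
        using near[OF that] g0 by (intro mult_mono) auto
      also have "exp (a * (x - u)) = exp (a * (m - u)) * exp (a * (x - m))"
        by (simp add: exp_add[symmetric] algebra_simps)
      finally show "ennreal (g t) * indicator {l..l + 1} x
          \<le> ennreal (exp (a * (m - u))) * (ennreal (g x) * ennreal (exp (a * (x - m))))"
        using g0 by (auto simp: indicator_def ennreal_mult[symmetric] ac_simps intro!: ennreal_leI)
    qed
    also have "\<dots> = ennreal (exp (a * (m - u))) * (\<integral>\<^sup>+x. ennreal (g x) * ennreal (exp (a * (x - m))) \<partial>lborel)"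
      by (rule nn_integral_cmult) measurable
    also have "\<dots> \<le> ennreal (exp (a * (m - u))) * ennreal (exp (1/2 * \<sigma>\<^sup>2 * a\<^sup>2))"
      by (intro mult_left_mono mgf) simp
    also have "\<dots> = ennreal (exp (a * (m - u) + 1/2 * \<sigma>\<^sup>2 * a\<^sup>2))"
      by (simp add: ennreal_mult[symmetric] exp_add)
    finally have "g t \<le> exp (a * (m - u) + 1/2 * \<sigma>\<^sup>2 * a\<^sup>2)"
      by (simp add: ennreal_le_iff)
    also have "a * (m - u) + 1/2 * \<sigma>\<^sup>2 * a\<^sup>2 = t * (m + sgn t) / \<sigma>\<^sup>2 + - t\<^sup>2 / (2 * \<sigma>\<^sup>2)"
      using s by (simp add: a_def u_def power2_eq_square field_simps)
    also have "t * (m + sgn t) / \<sigma>\<^sup>2 \<le> \<bar>t\<bar> * L"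
    proof -
      have "t * (m + sgn t) \<le> \<bar>t\<bar> * \<bar>m + sgn t\<bar>"
        by (metis abs_ge_self abs_mult)
      also have "\<dots> \<le> \<bar>t\<bar> * (\<bar>m\<bar> + 1)"
        by (intro mult_left_mono) (auto simp: sgn_if)
      finally have "t * (m + sgn t) / \<sigma>\<^sup>2 \<le> \<bar>t\<bar> * (\<bar>m\<bar> + 1) / \<sigma>\<^sup>2"
        by (rule divide_right_mono) simp
      then show ?thesis
        by (simp add: L_def)
    qed
    also have "\<bar>t\<bar> * L \<le> L\<^sup>2 / (4 * \<delta>) + \<delta> * t\<^sup>2"
    proof -
      have "0 \<le> (2 * \<delta> * \<bar>t\<bar> - L)\<^sup>2 / (4 * \<delta>)"
        using \<delta> by simp
      also have "\<dots> = L\<^sup>2 / (4 * \<delta>) + \<delta> * t\<^sup>2 - \<bar>t\<bar> * L"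
        using \<delta> by (simp add: power2_diff power_mult_distrib field_simps power2_eq_square)
      finally show ?thesis by simp
    qed
    finally have "g t \<le> exp (L\<^sup>2 / (4 * \<delta>) + \<delta> * t\<^sup>2 + - t\<^sup>2 / (2 * \<sigma>\<^sup>2))"
      by simp
    then show ?thesis
      by (simp only: exp_add)
  qed
  have center: "g t \<le> b * exp (1 / (2 * \<sigma>\<^sup>2)) * exp (\<delta> * t\<^sup>2) * exp (- t\<^sup>2 / (2 * \<sigma>\<^sup>2))" if t: "\<bar>t\<bar> \<le> 1" for t
  proof -
    have "t\<^sup>2 / (2 * \<sigma>\<^sup>2) \<le> 1 / (2 * \<sigma>\<^sup>2)"
      using t by (intro divide_right_mono) (auto simp: abs_square_le_1)
    then have "1 \<le> exp (1 / (2 * \<sigma>\<^sup>2) + \<delta> * t\<^sup>2 + - t\<^sup>2 / (2 * \<sigma>\<^sup>2))"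
      using \<delta> by (simp add: add_increasing2)
    then have "b * 1 \<le> b * exp (1 / (2 * \<sigma>\<^sup>2) + \<delta> * t\<^sup>2 + - t\<^sup>2 / (2 * \<sigma>\<^sup>2))"
      using b0 by (rule mult_left_mono)
    then show ?thesis
      using b[of t] by (simp only: exp_add mult.assoc)
  qed
  have le: "g t \<le> c0 * exp (\<delta> * t\<^sup>2) * exp (- t\<^sup>2 / (2 * \<sigma>\<^sup>2))" for t
  proof -
    have "0 \<le> exp (L\<^sup>2 / (4 * \<delta>)) * exp (\<delta> * t\<^sup>2) * exp (- t\<^sup>2 / (2 * \<sigma>\<^sup>2))"
        "0 \<le> b * exp (1 / (2 * \<sigma>\<^sup>2)) * exp (\<delta> * t\<^sup>2) * exp (- t\<^sup>2 / (2 * \<sigma>\<^sup>2))"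
      using b0 by simp_all
    then show ?thesis
      unfolding c0_def distrib_right using tail[of t] center[of t] by linarith
  qed
  show thesis
  proof (rule that[of "c0 * sqrt (2 * pi * \<sigma>\<^sup>2)"])
    show "0 < c0 * sqrt (2 * pi * \<sigma>\<^sup>2)"
      using s b0 by (simp add: c0_def add_pos_nonneg)
    show "g t \<le> c0 * sqrt (2 * pi * \<sigma>\<^sup>2) * exp (\<delta> * t\<^sup>2) * (exp (- t\<^sup>2 / (2 * \<sigma>\<^sup>2)) / sqrt (2 * pi * \<sigma>\<^sup>2))" for t
      using le[of t] s by simp
  qed
qed

lemma gaussian_density_eq_product:
  assumes s: "0 < \<sigma>"
  shows "gaussian_density d \<sigma> = product_density d (normal_density 0 \<sigma>)"
proof
  fix x
  have "sqrt (2 * pi * \<sigma>\<^sup>2) ^ d = (2 * pi * \<sigma>\<^sup>2) powr (real d / 2)"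
    using s by (intro sqrt_power_eq_powr) simp
  then show "gaussian_density d \<sigma> x = product_density d (normal_density 0 \<sigma>) x"
    by (simp add: gaussian_density_def product_density_def normal_density_def prod.distrib exp_sum[symmetric]
        prod_dividef vnorm_sq sum_negf sum_divide_distrib)
qed

lemma prob_density_normal: "0 < \<sigma> \<Longrightarrow> prob_density (normal_density m \<sigma>)"
  by (simp add: prob_density_def nn_integral_eq_integral)

lemma product_density_le_gaussian:
  assumes g: "prob_density g" and s: "0 < \<sigma>"
    and env: "\<And>t. g t \<le> c * exp (\<delta> * t\<^sup>2) * (exp (- t\<^sup>2 / (2 * \<sigma>\<^sup>2)) / sqrt (2 * pi * \<sigma>\<^sup>2))"
  shows "product_density d g t \<le> c ^ d * exp (\<delta> * (vnorm d t)\<^sup>2) * gaussian_density d \<sigma> t"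
proof -
  have "product_density d g t \<le> (\<Prod>j<d. c * exp (\<delta> * (t j)\<^sup>2) * normal_density 0 \<sigma> (t j))"
    unfolding product_density_def using g env
    by (intro prod_mono) (auto simp: prob_density_def normal_density_def)
  also have "\<dots> = c ^ d * exp (\<delta> * (vnorm d t)\<^sup>2) * gaussian_density d \<sigma> t"
    by (simp add: gaussian_density_eq_product[OF s] product_density_def prod.distrib vnorm_sq sum_distrib_left exp_sum)
  finally show ?thesis .
qed

text \<open>
  By \<open>\<parallel>x\<parallel> \<le> 1 + \<parallel>x\<parallel>\<^sup>2\<close> the first moment reduces to the total mass and a Gaussian second moment.
\<close>

lemma product_law_in_P1:
  assumes g: "prob_density g" and a: "0 < a"
    and env: "\<And>t. g t \<le> C * exp (- a * t\<^sup>2)"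
  shows "product_law d g \<in> P1 d"
proof -
  have C: "0 \<le> C"
    using env[of 0] g by (auto simp: prob_density_def intro: order_trans)
  have le: "product_density d g x \<le> C ^ d * exp (- a * (vnorm d x)\<^sup>2)" for x
  proof -
    have "product_density d g x \<le> (\<Prod>j<d. C * exp (- a * (x j)\<^sup>2))"
      unfolding product_density_def using g env by (intro prod_mono) (auto simp: prob_density_def)
    also have "\<dots> = C ^ d * exp (- a * (vnorm d x)\<^sup>2)"
      by (simp add: prod.distrib vnorm_sq sum_distrib_left exp_sum[symmetric] sum_negf)
    finally show ?thesis .
  qed
  have vm [measurable]: "vnorm d \<in> borel_measurable (borel_vec d)"
    using measurable_vnorm_centered[of d "\<lambda>_. 0"] by simp
  note [measurable] = measurable_product_density[OF g]
  note k0 = product_density_nonneg[OF g]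
  have "(\<integral>\<^sup>+x. ennreal (vnorm d x) \<partial>product_law d g)
      = (\<integral>\<^sup>+x. ennreal (product_density d g x) * ennreal (vnorm d x) \<partial>lborel_vec d)"
    unfolding product_law_def by (rule nn_integral_density) measurable
  also have "\<dots> \<le> (\<integral>\<^sup>+x. ennreal (product_density d g x)
      + ennreal (C ^ d) * ennreal ((vnorm d (\<lambda>i. x i - 0))\<^sup>2 * exp (- a * (vnorm d (\<lambda>i. x i - 0))\<^sup>2)) \<partial>lborel_vec d)"
  proof (rule nn_integral_mono)
    fix x
    have "vnorm d x \<le> 1 + (vnorm d x)\<^sup>2"
    proof -
      have "2 * vnorm d x \<le> (vnorm d x)\<^sup>2 + 1"
        using zero_le_power2[of "vnorm d x - 1"] by (simp add: power2_diff)
      then show ?thesis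
        using vnorm_nonneg[of d x] by linarith
    qed
    then have "product_density d g x * vnorm d x \<le> product_density d g x * (1 + (vnorm d x)\<^sup>2)"
      by (rule mult_left_mono) (rule k0)
    also have "\<dots> \<le> product_density d g x + (C ^ d * exp (- a * (vnorm d x)\<^sup>2)) * (vnorm d x)\<^sup>2"
      using mult_right_mono[OF le[of x], of "(vnorm d x)\<^sup>2"] by (simp add: distrib_left)
    finally show "ennreal (product_density d g x) * ennreal (vnorm d x)
        \<le> ennreal (product_density d g x)
      + ennreal (C ^ d) * ennreal ((vnorm d (\<lambda>i. x i - 0))\<^sup>2 * exp (- a * (vnorm d (\<lambda>i. x i - 0))\<^sup>2))"
      using C k0 by (simp flip: ennreal_mult ennreal_plus) (simp add: ac_simps)
  qed
  also have "\<dots> = 1 + ennreal (C ^ d) *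
      (\<integral>\<^sup>+x. ennreal ((vnorm d (\<lambda>i. x i - 0))\<^sup>2 * exp (- a * (vnorm d (\<lambda>i. x i - 0))\<^sup>2)) \<partial>lborel_vec d)"
    by (simp add: nn_integral_add nn_integral_cmult nn_integral_product_density[OF g])
  also have "\<dots> \<le> 1 + ennreal (C ^ d) * ennreal (2 / a * sqrt (2 * pi / a) ^ d)"
    by (intro add_left_mono mult_left_mono gaussian_second_moment_le[OF a]) simp
  also have "\<dots> < \<infinity>"
    by (simp add: ennreal_mult_less_top)
  finally have "integrable (product_law d g) (vnorm d)"
    by (intro integrableI_bounded) (simp_all cong: measurable_cong_sets)
  then show ?thesis
    using prob_space_product_law[OF g] by (simp add: P1_def)
qed

lemma rate_const_exp_linear:
  assumes "0 < c\<^sub>1" "0 < \<sigma>" "0 < K"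
  shows "\<exists>h. h \<in> O(\<lambda>d. real d) \<and> (\<forall>d \<ge> 1. rate_const c\<^sub>1 \<sigma> d K = exp (h d))"
proof (intro exI conjI allI impI)
  let ?h = "\<lambda>d. ln (rate_const c\<^sub>1 \<sigma> d K)"
  have pos: "0 < 1 + K / \<sigma>" using assms by (simp add: add_pos_pos)
  fix d :: nat assume d: "1 \<le> d"
  have "0 < rate_const c\<^sub>1 \<sigma> d K"
    unfolding rate_const_def using assms d pos by (intro mult_pos_pos) auto
  then show "rate_const c\<^sub>1 \<sigma> d K = exp (?h d)" by simp
next
  let ?h = "\<lambda>d. ln (rate_const c\<^sub>1 \<sigma> d K)"
  have pos: "1 < 1 + K / \<sigma>" using assms by simp
  define C where "C = \<bar>ln c\<^sub>1\<bar> + \<bar>ln \<sigma>\<bar> + 1 + 2 * ln (1 + K / \<sigma>) + 1"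
  show "?h \<in> O(\<lambda>d. real d)"
  proof (rule bigoI)
    show "\<forall>\<^sub>F d in sequentially. norm (?h d) \<le> C * norm (real d)"
    proof (rule eventually_sequentiallyI)
      fix d :: nat assume d: "1 \<le> d"
      define D where "D = real d"
      have D: "1 \<le> D" using d by (simp add: D_def)
      define R where "R = ln (1 + K / \<sigma>)"
      have R: "0 \<le> R" using pos by (simp add: R_def)
      have "?h d = D * ln c\<^sub>1 + ln \<sigma> + ln (2 * D) / 2 + (D / 2 + 1) * R + 3 * D / 16"
        unfolding rate_const_def using assms pos less_imp_neq[OF less_trans[OF zero_less_one pos]] d
        by (simp add: ln_mult ln_realpow ln_sqrt ln_powr D_def R_def)
      moreover have "\<bar>D * ln c\<^sub>1\<bar> \<le> \<bar>ln c\<^sub>1\<bar> * D"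
        using D by (simp add: abs_mult)
      moreover have "\<bar>ln \<sigma>\<bar> \<le> \<bar>ln \<sigma>\<bar> * D"
        using D by (simp add: mult_le_cancel_left1)
      moreover have "0 \<le> ln (2 * D)" "ln (2 * D) \<le> 2 * D - 1"
        using D by (auto intro: ln_le_minus_one)
      moreover have "0 \<le> (D / 2 + 1) * R" "(D / 2 + 1) * R \<le> (2 * D) * R"
        using D R by (simp, intro mult_right_mono) auto
      ultimately have "\<bar>?h d\<bar> \<le> \<bar>ln c\<^sub>1\<bar> * D + \<bar>ln \<sigma>\<bar> * D + D + (2 * D) * R + D"
        using D by linarith
      then show "norm (?h d) \<le> C * norm (real d)"
        by (simp add: C_def D_def R_def algebra_simps)
    qed
  qed
qed

theorem theorem5:
  fixes \<sigma> \<delta> :: real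
  assumes sigma_pos: "0 < \<sigma>"
    and delta: "\<delta> = min 1 (1 / (4 * \<sigma>\<^sup>2))"
  shows
    "(\<forall>g :: real \<Rightarrow> real.
        prob_density g \<and> subgaussian_density \<sigma> g \<and> bounded (range g) \<and> decreasing_from_zero g
        \<longrightarrow>
        (\<exists>c\<^sub>1 > 0.
           (\<forall>d \<ge> 1.
              product_law d g \<in> P1 d \<and>
              (\<forall>t. product_density d g t
                     \<le> c\<^sub>1 ^ d * exp (\<delta> * (vnorm d t)\<^sup>2) * gaussian_density d \<sigma> t) \<and>
              (\<forall>K > 0. \<forall>\<mu>. subgaussian d K \<mu> \<longrightarrow>
                 (\<forall>n \<ge> 1. expected_smooth_W1 d (product_law d g) \<mu> n
                            \<le> ennreal (rate_const c\<^sub>1 \<sigma> d K * real n powr (-1/2))))) \<and>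
           (\<forall>K > 0. \<exists>h. h \<in> O(\<lambda>d. real d) \<and>
              (\<forall>d \<ge> 1. rate_const c\<^sub>1 \<sigma> d K = exp (h d))))) \<and>
     (\<forall>d \<ge> 1. \<forall>K > 0. \<exists>C > 0. \<forall>\<mu>. subgaussian d K \<mu> \<longrightarrow>
        (\<forall>n \<ge> 1. expected_smooth_W1 d (gaussian_law d \<sigma>) \<mu> n
                   \<le> ennreal (C * real n powr (-1/2))) \<and>
        (\<lambda>n. enn2real (expected_smooth_W1 d (gaussian_law d \<sigma>) \<mu> n))
          \<in> O(\<lambda>n. real n powr (-1/2)))"
proof -
  have \<delta>: "0 < \<delta>" "\<delta> \<le> 1 / (4 * \<sigma>\<^sup>2)"
    using sigma_pos by (simp_all add: delta)
  have general: "\<exists>c\<^sub>1 > 0.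
           (\<forall>d \<ge> 1.
              product_law d g \<in> P1 d \<and>
              (\<forall>t. product_density d g t
                     \<le> c\<^sub>1 ^ d * exp (\<delta> * (vnorm d t)\<^sup>2) * gaussian_density d \<sigma> t) \<and>
              (\<forall>K > 0. \<forall>\<mu>. subgaussian d K \<mu> \<longrightarrow>
                 (\<forall>n \<ge> 1. expected_smooth_W1 d (product_law d g) \<mu> n
                            \<le> ennreal (rate_const c\<^sub>1 \<sigma> d K * real n powr (-1/2))))) \<and>
           (\<forall>K > 0. \<exists>h. h \<in> O(\<lambda>d. real d) \<and>
              (\<forall>d \<ge> 1. rate_const c\<^sub>1 \<sigma> d K = exp (h d)))"
    if g: "prob_density g" and sub: "subgaussian_density \<sigma> g" and bdd: "bounded (range g)"
      and dec: "decreasing_from_zero g" for g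
  proof -
    obtain c where c: "0 < c"
      and env: "\<And>t. g t \<le> c * exp (\<delta> * t\<^sup>2) * (exp (- t\<^sup>2 / (2 * \<sigma>\<^sup>2)) / sqrt (2 * pi * \<sigma>\<^sup>2))"
      by (rule subgaussian_density_envelope[OF sub bdd dec sigma_pos \<delta>(1)]) (rule that)
    \<comment> \<open>The bound on \<open>\<delta>\<close> leaves half of the Gaussian exponent, as the rate bound demands.\<close>
    have env4: "g t \<le> c * exp (- t\<^sup>2 / (4 * \<sigma>\<^sup>2)) / sqrt (2 * pi * \<sigma>\<^sup>2)" for t
    proof -
      have "\<delta> * t\<^sup>2 \<le> 1 / (4 * \<sigma>\<^sup>2) * t\<^sup>2"
        using \<delta> by (intro mult_right_mono) auto
      also have "\<dots> = - t\<^sup>2 / (4 * \<sigma>\<^sup>2) + t\<^sup>2 / (2 * \<sigma>\<^sup>2)"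
        by simp
      finally have "exp (\<delta> * t\<^sup>2) * exp (- t\<^sup>2 / (2 * \<sigma>\<^sup>2)) \<le> exp (- t\<^sup>2 / (4 * \<sigma>\<^sup>2))"
        by (simp add: exp_add[symmetric])
      then have "c * (exp (\<delta> * t\<^sup>2) * exp (- t\<^sup>2 / (2 * \<sigma>\<^sup>2))) / sqrt (2 * pi * \<sigma>\<^sup>2)
          \<le> c * exp (- t\<^sup>2 / (4 * \<sigma>\<^sup>2)) / sqrt (2 * pi * \<sigma>\<^sup>2)"
        using c by (intro divide_right_mono mult_left_mono) auto
      then show ?thesis
        using env[of t] by (simp add: mult.assoc)
    qed
    have P1: "product_law d g \<in> P1 d" for d
    proof (rule product_law_in_P1[OF g, of "1 / (4 * \<sigma>\<^sup>2)" "c / sqrt (2 * pi * \<sigma>\<^sup>2)"])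
      show "g t \<le> c / sqrt (2 * pi * \<sigma>\<^sup>2) * exp (- (1 / (4 * \<sigma>\<^sup>2)) * t\<^sup>2)" for t
        using env4[of t] by simp
    qed (use sigma_pos in simp)
    have dens: "product_density d g t \<le> (12 * c) ^ d * exp (\<delta> * (vnorm d t)\<^sup>2) * gaussian_density d \<sigma> t" for d t
    proof (rule product_density_le_gaussian[OF g sigma_pos])
      fix t
      have "c * (exp (\<delta> * t\<^sup>2) * (exp (- t\<^sup>2 / (2 * \<sigma>\<^sup>2)) / sqrt (2 * pi * \<sigma>\<^sup>2)))
          \<le> 12 * c * (exp (\<delta> * t\<^sup>2) * (exp (- t\<^sup>2 / (2 * \<sigma>\<^sup>2)) / sqrt (2 * pi * \<sigma>\<^sup>2)))"
        using c by (intro mult_right_mono) auto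
      then show "g t \<le> 12 * c * exp (\<delta> * t\<^sup>2) * (exp (- t\<^sup>2 / (2 * \<sigma>\<^sup>2)) / sqrt (2 * pi * \<sigma>\<^sup>2))"
        using env[of t] by (simp only: mult.assoc)
    qed
    show ?thesis
      using c P1 dens expected_smooth_W1_le[OF g sigma_pos c env4]
        rate_const_exp_linear[of "12 * c" \<sigma>] sigma_pos
      by (intro exI[of _ "12 * c"]) auto
  qed
  have gaussian: "\<exists>C > 0. \<forall>\<mu>. subgaussian d K \<mu> \<longrightarrow>
        (\<forall>n \<ge> 1. expected_smooth_W1 d (gaussian_law d \<sigma>) \<mu> n
                   \<le> ennreal (C * real n powr (-1/2))) \<and>
        (\<lambda>n. enn2real (expected_smooth_W1 d (gaussian_law d \<sigma>) \<mu> n))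
          \<in> O(\<lambda>n. real n powr (-1/2))" if d: "1 \<le> d" and K: "0 < K" for d :: nat and K :: real
  proof (intro exI conjI allI impI)
    \<comment> \<open>The normal density lies below the envelope with constant \<open>1\<close>.\<close>
    let ?C = "rate_const (12 * 1) \<sigma> d K"
    have "0 < 1 + K / \<sigma>" using K sigma_pos by (simp add: add_pos_pos)
    then show C: "0 < ?C"
      unfolding rate_const_def using d sigma_pos by (intro mult_pos_pos) auto
    fix \<mu> assume sub: "subgaussian d K \<mu>"
    have env: "normal_density 0 \<sigma> t \<le> 1 * exp (- t\<^sup>2 / (4 * \<sigma>\<^sup>2)) / sqrt (2 * pi * \<sigma>\<^sup>2)" for t
    proof -
      have "t\<^sup>2 / (4 * \<sigma>\<^sup>2) \<le> t\<^sup>2 / (2 * \<sigma>\<^sup>2)"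
        using sigma_pos by (intro divide_left_mono) auto
      then show ?thesis
        by (simp add: normal_density_def divide_right_mono)
    qed
    have law: "gaussian_law d \<sigma> = product_law d (normal_density 0 \<sigma>)"
      by (simp add: gaussian_law_def product_law_def gaussian_density_eq_product[OF sigma_pos])
    have bound: "expected_smooth_W1 d (gaussian_law d \<sigma>) \<mu> n \<le> ennreal (?C * real n powr (-1/2))" if "1 \<le> n" for n
      unfolding law
      by (rule expected_smooth_W1_le[OF prob_density_normal[OF sigma_pos] sigma_pos zero_less_one env K sub d that])
    show "expected_smooth_W1 d (gaussian_law d \<sigma>) \<mu> n \<le> ennreal (?C * real n powr (-1/2))" if "1 \<le> n" for n
      by (rule bound[OF that])
    show "(\<lambda>n. enn2real (expected_smooth_W1 d (gaussian_law d \<sigma>) \<mu> n)) \<in> O(\<lambda>n. real n powr (-1/2))"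
    proof (rule bigoI, rule eventually_sequentiallyI)
      fix n :: nat assume "1 \<le> n"
      from enn2real_mono[OF bound[OF this]] C
      show "norm (enn2real (expected_smooth_W1 d (gaussian_law d \<sigma>) \<mu> n)) \<le> ?C * norm (real n powr (-1/2))"
        by simp
    qed
  qed
  show ?thesis
    using general gaussian by blast
qed

end
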